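(* The infima $E_A=\inf_\mu I_A(\mu)$, $E_C=\inf_\mu I_C(\mu)$ and $E_{BC}=\inf_\mu I_{BC}(\mu)$ (over Borel probability measures $\mu$ on $\mathbb R$; the functionals, which depend on $c,t,\beta,\delta$, are defined in the context) are finite. In addition, let $M$ be a classical irreducible symmetric space of non-compact type, of rank $r$, with associated integral $Z_{\mathfrak a}(\sigma)$, and suppose that the constant $c>0$ determining the metric does not depend on $r$. Then for any $t>0$ the following limits hold when $r\to\infty$ while $t=r\sigma^2$ remains constant: - $A_r$ root system: $\displaystyle\lim_{r\to\infty}\frac1{r^2}\log\left(Z_{\mathfrak a}(\sigma)\right)=-E_A$. - $B_r$ root system: $\displaystyle\lim_{r\to\infty}\frac1{r^2}\log\left(Z_{\mathfrak a}(\sigma)\right)=-E_{BC}$, under the additional assumption that $\alpha=\beta(\delta-1)r$ for some constant $\delta\ge1$. - $C_r$ or $D_r$ root system: $\displaystyle\lim_{r\to\infty}\frac1{r^2}\log\left(Z_{\mathfrak a}(\sigma)\right)=-E_C$. - $(BC)_r$ root system: $\displaystyle\lim_{r\to\infty}\frac1{r^2}\log\left(Z_{\mathfrak a}(\sigma)\right)=-E_{BC}$, under the additional assumption that $\alpha=\beta(\delta-1)r$ for some constant $\delta\ge1$. On the other hand, the limit is equal to $-E_C$ if $\alpha=4$ or $0$ independent of $r$.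
   Context: The integrals. $Z_{\mathfrak a}(\sigma)=\int_{\mathfrak a}e^{-\Vert a\Vert^2/2\sigma^2}\prod_{\lambda\in\Delta_+}|\sinh\lambda(a)|^{m_\lambda}da$, where $\mathfrak a$ is a maximal abelian subspace of $\mathfrak p$ ($\mathfrak g=\mathfrak k+\mathfrak p$ the Cartan decomposition), $\Delta_+$ the positive restricted roots and $m_\lambda$ their multiplicities. Explicitly, identifying $a\in\mathfrak a$ with a real array $(a_i)$, with $i=1,\dots,r$, except for $A_r$ where $i=1,\dots,r+1$ and $\mathfrak a=\{a\in\mathbb R^{r+1}:\sum_i a_i=0\}$, $Z_{\mathfrak a}(\sigma)$ equals the integral over $\mathfrak a$, with respect to Lebesgue measure, of $e^{-\frac{c}{2\sigma^2}\sum_i a_i^2}$ times - $A_r$: $\prod_{i<j}|\sinh(a_i-a_j)|^\beta$; - $B_r$: $\prod_{i<j}|\sinh(a_i-a_j)\sinh(a_i+a_j)|^\beta\prod_i|\sinh(a_i)|^\alpha$; - $C_r$: $\prod_{i<j}|\sinh(a_i-a_j)\sinh(a_i+a_j)|^\beta\prod_i|\sinh(2a_i)|^\gamma$; - $D_r$: $\prod_{i<j}|\sinh(a_i-a_j)\sinh(a_i+a_j)|^\beta$; - $(BC)_r$: $\prod_{i<j}|\sinh(a_i-a_j)\sinh(a_i+a_j)|^\beta\prod_i|\sinh(a_i)|^\alpha|\sinh(2a_i)|^\gamma$. Here $c>0$ is a constant determining the choice of the Riemannian metric. In each family $\beta$ and $\gamma$ are fixed (independent of $r$). The families and multiplicities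 are: $\mathrm{SL}(n,\mathbb R)/\mathrm{SO}(n)$, $\mathrm{SL}(n,\mathbb C)/\mathrm{SU}(n)$, $\mathrm{SL}(n,\mathbb H)/\mathrm{Sp}(n)$: type $A$, rank $n-1$, $\beta=1,2,4$ respectively; $\mathrm{SO}_o(p,q)/\mathrm{SO}(p)\times\mathrm{SO}(q)$, $p\le q$: type $B$ (or $D$ if $q=p$), rank $p$, $\alpha=q-p$, $\beta=1$; $\mathrm{SO}(2r+1,\mathbb C)/\mathrm{SO}(2r+1)$: type $B$, $\alpha=\beta=2$; $\mathrm{SO}(2r,\mathbb C)/\mathrm{SO}(2r)$: type $D$, $\beta=2$; $\mathrm{Sp}(r,\mathbb R)/\mathrm U(r)$: type $C$, $\beta=\gamma=1$; $\mathrm{Sp}(r,\mathbb C)/\mathrm{Sp}(r)$: type $C$, $\beta=\gamma=2$; $\mathrm{SU}(p,q)/\mathrm S(\mathrm U(p)\times\mathrm U(q))$, $p\le q$: type $BC$ (or $C$ if $q=p$), rank $p$, $\alpha=2(q-p)$, $\beta=2$, $\gamma=1$; $\mathrm{Sp}(p,q)/\mathrm{Sp}(p)\times\mathrm{Sp}(q)$, $p\le q$: type $BC$ (or $C$ if $q=p$), rank $p$, $\alpha=4(q-p)$, $\beta=4$, $\gamma=3$; $\mathrm{SO}^*(2n)/\mathrm U(n)$: type $BC$ or $C$, rank $\lfloor n/2\rfloor$, $\alpha=4$ if $n$ is odd and $0$ if $n$ is even, $\beta=4$, $\gamma=1$. (The assumption $\alpha=\beta(\delta-1)r$ corresponds to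 $r=p$, $\alpha=\beta(q-p)$, $q=\delta p$.) The functionals. With $\ell(x)=\log|\sinh(x)|$ and $\delta\ge1$, $$I_A(\mu)=\frac c{2t}\int x^2\mu(dx)-\frac\beta2\iint\ell(x-y)\mu(dx)\mu(dy),$$ $$I_C(\mu)=\frac c{2t}\int x^2\mu(dx)-\frac\beta2\iint\left(\ell(x-y)+\ell(x+y)\right)\mu(dx)\mu(dy),$$ $$I_{BC}(\mu)=\int\left(\frac c{2t}x^2-\beta(\delta-1)\ell(x)\right)\mu(dx)-\frac\beta2\iint\left(\ell(x-y)+\ell(x+y)\right)\mu(dx)\mu(dy).$$ Each is understood as the single integral $\iint k(x,y)\mu(dx)\mu(dy)\in\mathbb R\cup\{+\infty\}$ with $k(x,y)=\frac12V(x)+\frac12V(y)-\frac\beta2L(x,y)$, where $V$ is the integrand of the single integral and $L$ the integrand of the double integral; this $k$ is bounded below. *)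

theory Defs
  imports "HOL-Probability.Probability"
begin

subsection \<open>Restricted root systems of the classical symmetric spaces\<close>

datatype root_type = Type_A | Type_B | Type_C | Type_D | Type_BC

text \<open>
  Besides the root system and the rank, the multiplicities: \<open>mult_beta\<close> belongs to the roots
  \<open>a\<^sub>i \<plusminus> a\<^sub>j\<close>, \<open>mult_alpha\<close> to the roots \<open>a\<^sub>i\<close>, and \<open>mult_gamma\<close> to the roots \<open>2 a\<^sub>i\<close>.
  The multiplicity of an absent kind of root is recorded as \<open>0\<close>.
\<close>

datatype restricted_roots =
  Restricted_Roots (root_type: root_type) (root_rank: nat)
    (mult_alpha: nat) (mult_beta: nat) (mult_gamma: nat)

datatype symmetric_space =
    SL_R nat           \<comment> \<open>\<open>SL(n,R)/SO(n)\<close>\<close>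
  | SL_C nat           \<comment> \<open>\<open>SL(n,C)/SU(n)\<close>\<close>
  | SL_H nat           \<comment> \<open>\<open>SL(n,H)/Sp(n)\<close>\<close>
  | SO_real nat nat    \<comment> \<open>identity component of \<open>SO(p,q)\<close>, modulo \<open>SO(p) \<times> SO(q)\<close>\<close>
  | SO_C_odd nat       \<comment> \<open>\<open>SO(2r+1,C)/SO(2r+1)\<close>\<close>
  | SO_C_even nat      \<comment> \<open>\<open>SO(2r,C)/SO(2r)\<close>\<close>
  | Sp_R nat           \<comment> \<open>\<open>Sp(r,R)/U(r)\<close>\<close>
  | Sp_C nat           \<comment> \<open>\<open>Sp(r,C)/Sp(r)\<close>\<close>
  | SU_pq nat nat      \<comment> \<open>\<open>SU(p,q)/S(U(p) \<times> U(q))\<close>\<close>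
  | Sp_pq nat nat      \<comment> \<open>\<open>Sp(p,q)/Sp(p) \<times> Sp(q)\<close>\<close>
  | SO_star nat        \<comment> \<open>\<open>SO*(2n)/U(n)\<close>\<close>

text \<open>
  The parameters for which the quotient is an irreducible symmetric space of non-compact type.
  Excluded are the flat spaces of \<open>SO(1,1)\<close> and \<open>SO(2,C)\<close> and the products of two hyperbolic
  spaces coming from \<open>SO(2,2)\<close> and \<open>SO(4,C)\<close>.
\<close>

fun irreducible_noncompact :: "symmetric_space \<Rightarrow> bool" where
  "irreducible_noncompact (SL_R n) \<longleftrightarrow> 2 \<le> n"
| "irreducible_noncompact (SL_C n) \<longleftrightarrow> 2 \<le> n"
| "irreducible_noncompact (SL_H n) \<longleftrightarrow> 2 \<le> n"
| "irreducible_noncompact (SO_real p q) \<longleftrightarrow>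
     1 \<le> p \<and> p \<le> q \<and> (p, q) \<noteq> (1, 1) \<and> (p, q) \<noteq> (2, 2)"
| "irreducible_noncompact (SO_C_odd r) \<longleftrightarrow> 1 \<le> r"
| "irreducible_noncompact (SO_C_even r) \<longleftrightarrow> 3 \<le> r"
| "irreducible_noncompact (Sp_R r) \<longleftrightarrow> 1 \<le> r"
| "irreducible_noncompact (Sp_C r) \<longleftrightarrow> 1 \<le> r"
| "irreducible_noncompact (SU_pq p q) \<longleftrightarrow> 1 \<le> p \<and> p \<le> q"
| "irreducible_noncompact (Sp_pq p q) \<longleftrightarrow> 1 \<le> p \<and> p \<le> q"
| "irreducible_noncompact (SO_star n) \<longleftrightarrow> 2 \<le> n"

fun roots_of :: "symmetric_space \<Rightarrow> restricted_roots" where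
  "roots_of (SL_R n) = Restricted_Roots Type_A (n - 1) 0 1 0"
| "roots_of (SL_C n) = Restricted_Roots Type_A (n - 1) 0 2 0"
| "roots_of (SL_H n) = Restricted_Roots Type_A (n - 1) 0 4 0"
| "roots_of (SO_real p q) =
     Restricted_Roots (if p = q then Type_D else Type_B) p (q - p) 1 0"
| "roots_of (SO_C_odd r) = Restricted_Roots Type_B r 2 2 0"
| "roots_of (SO_C_even r) = Restricted_Roots Type_D r 0 2 0"
| "roots_of (Sp_R r) = Restricted_Roots Type_C r 0 1 1"
| "roots_of (Sp_C r) = Restricted_Roots Type_C r 0 2 2"
| "roots_of (SU_pq p q) =
     Restricted_Roots (if p = q then Type_C else Type_BC) p (2 * (q - p)) 2 1"
| "roots_of (Sp_pq p q) =
     Restricted_Roots (if p = q then Type_C else Type_BC) p (4 * (q - p)) 4 3"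
| "roots_of (SO_star n) =
     (if even n then Restricted_Roots Type_C (n div 2) 0 4 1
      else Restricted_Roots Type_BC (n div 2) 4 4 1)"

subsection \<open>The integrals\<close>

text \<open>
  Elements of the maximal abelian subspace are arrays indexed by \<open>{..<num_coords R}\<close>. For
  type A the subspace is the hyperplane of arrays with sum zero, parametrised by the first
  \<open>r\<close> coordinates; \<open>sqrt (r + 1)\<close> is the square root of the Gram determinant of
  this parametrisation, so that the result is the Euclidean Lebesgue measure of the hyperplane.
\<close>

definition num_coords :: "restricted_roots \<Rightarrow> nat" where
  "num_coords R = (if root_type R = Type_A then root_rank R + 1 else root_rank R)"

definition flat_measure :: "restricted_roots \<Rightarrow> (nat \<Rightarrow> real) measure" where
  "flat_measure R = (let r = root_rank R in
     if root_type R = Type_A then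
       scale_measure (ennreal (sqrt (real r + 1)))
         (distr (\<Pi>\<^sub>M i\<in>{..<r}. lborel) (\<Pi>\<^sub>M i\<in>{..<r + 1}. lborel)
            (\<lambda>a. a(r := - (\<Sum>i<r. a i))))
     else (\<Pi>\<^sub>M i\<in>{..<r}. lborel))"

definition root_density :: "restricted_roots \<Rightarrow> (nat \<Rightarrow> real) \<Rightarrow> real" where
  "root_density R a = (let N = num_coords R; \<alpha> = mult_alpha R; \<beta> = mult_beta R; \<gamma> = mult_gamma R;
       minus_part = (\<Prod>j<N. \<Prod>i<j. \<bar>sinh (a i - a j)\<bar> ^ \<beta>);
       both_part = (\<Prod>j<N. \<Prod>i<j. \<bar>sinh (a i - a j) * sinh (a i + a j)\<bar> ^ \<beta>)
     in case root_type R of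
       Type_A \<Rightarrow> minus_part
     | Type_B \<Rightarrow> both_part * (\<Prod>i<N. \<bar>sinh (a i)\<bar> ^ \<alpha>)
     | Type_C \<Rightarrow> both_part * (\<Prod>i<N. \<bar>sinh (2 * a i)\<bar> ^ \<gamma>)
     | Type_D \<Rightarrow> both_part
     | Type_BC \<Rightarrow> both_part * (\<Prod>i<N. \<bar>sinh (a i)\<bar> ^ \<alpha> * \<bar>sinh (2 * a i)\<bar> ^ \<gamma>))"

definition Z_flat :: "real \<Rightarrow> restricted_roots \<Rightarrow> real \<Rightarrow> real" where
  "Z_flat c R \<sigma> =
     (\<integral>a. exp (- (c / (2 * \<sigma>\<^sup>2)) * (\<Sum>i<num_coords R. (a i)\<^sup>2)) * root_density R a \<partial>flat_measure R)"

subsection \<open>The energy functionals\<close>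

text \<open>The case distinction is needed because \<open>ln 0 = 0\<close> in the library.\<close>

definition log_sinh :: "real \<Rightarrow> ereal" where
  "log_sinh x = (if x = 0 then - \<infinity> else ereal (ln \<bar>sinh x\<bar>))"

definition ereal_integral :: "'a measure \<Rightarrow> ('a \<Rightarrow> ereal) \<Rightarrow> ereal" where
  "ereal_integral M f =
     enn2ereal (\<integral>\<^sup>+ x. e2ennreal (f x) \<partial>M) - enn2ereal (\<integral>\<^sup>+ x. e2ennreal (- f x) \<partial>M)"

definition energy ::
  "real \<Rightarrow> (real \<Rightarrow> ereal) \<Rightarrow> (real \<Rightarrow> real \<Rightarrow> ereal) \<Rightarrow> real measure \<Rightarrow> ereal" where
  "energy \<beta> V L \<mu> = ereal_integral (\<mu> \<Otimes>\<^sub>M \<mu>)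
     (\<lambda>(x, y). ereal (1 / 2) * V x + ereal (1 / 2) * V y - ereal (\<beta> / 2) * L x y)"

definition I_A :: "real \<Rightarrow> real \<Rightarrow> real \<Rightarrow> real measure \<Rightarrow> ereal" where
  "I_A c t \<beta> = energy \<beta> (\<lambda>x. ereal (c / (2 * t) * x\<^sup>2)) (\<lambda>x y. log_sinh (x - y))"

definition I_C :: "real \<Rightarrow> real \<Rightarrow> real \<Rightarrow> real measure \<Rightarrow> ereal" where
  "I_C c t \<beta> = energy \<beta> (\<lambda>x. ereal (c / (2 * t) * x\<^sup>2))
     (\<lambda>x y. log_sinh (x - y) + log_sinh (x + y))"

definition I_BC :: "real \<Rightarrow> real \<Rightarrow> real \<Rightarrow> real \<Rightarrow> real measure \<Rightarrow> ereal" where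
  "I_BC c t \<beta> \<delta> = energy \<beta>
     (\<lambda>x. ereal (c / (2 * t) * x\<^sup>2) - ereal (\<beta> * (\<delta> - 1)) * log_sinh x)
     (\<lambda>x y. log_sinh (x - y) + log_sinh (x + y))"

definition borel_prob_measures :: "real measure set" where
  "borel_prob_measures = {\<mu>. prob_space \<mu> \<and> sets \<mu> = sets borel}"

definition E_A :: "real \<Rightarrow> real \<Rightarrow> real \<Rightarrow> ereal" where
  "E_A c t \<beta> = (INF \<mu>\<in>borel_prob_measures. I_A c t \<beta> \<mu>)"

definition E_C :: "real \<Rightarrow> real \<Rightarrow> real \<Rightarrow> ereal" where
  "E_C c t \<beta> = (INF \<mu>\<in>borel_prob_measures. I_C c t \<beta> \<mu>)"

definition E_BC :: "real \<Rightarrow> real \<Rightarrow> real \<Rightarrow> real \<Rightarrow> ereal" where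
  "E_BC c t \<beta> \<delta> = (INF \<mu>\<in>borel_prob_measures. I_BC c t \<beta> \<delta> \<mu>)"

subsection \<open>The limit of large rank\<close>

text \<open>
  Within one root system, the values of \<open>\<beta>\<close> and \<open>\<gamma>\<close> determine the family of symmetric spaces,
  so fixing both is the same as letting the rank tend to infinity inside one family. A sequence
  is used because, within a family, a given rank may occur for several spaces or (under a
  condition such as \<open>\<alpha> = \<beta> (\<delta> - 1) r\<close>) for none.
\<close>

definition large_rank_sequence ::
  "real \<Rightarrow> nat \<Rightarrow> nat \<Rightarrow> (nat \<Rightarrow> symmetric_space) \<Rightarrow> (nat \<Rightarrow> real) \<Rightarrow> bool" where
  "large_rank_sequence t \<beta> \<gamma> M \<sigma> \<longleftrightarrow>
     (\<forall>n. irreducible_noncompact (M n) \<and> mult_beta (roots_of (M n)) = \<beta> \<and>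
          mult_gamma (roots_of (M n)) = \<gamma> \<and>
          \<sigma> n > 0 \<and> t = real (root_rank (roots_of (M n))) * (\<sigma> n)\<^sup>2) \<and>
     filterlim (\<lambda>n. root_rank (roots_of (M n))) at_top sequentially"

definition has_log_limit ::
  "real \<Rightarrow> (nat \<Rightarrow> symmetric_space) \<Rightarrow> (nat \<Rightarrow> real) \<Rightarrow> ereal \<Rightarrow> bool" where
  "has_log_limit c M \<sigma> l \<longleftrightarrow>
     (\<lambda>n. ereal (1 / (real (root_rank (roots_of (M n))))\<^sup>2 * ln (Z_flat c (roots_of (M n)) (\<sigma> n))))
       \<longlonglongrightarrow> l"

end

theory Submission
  imports Defs "HOL-Real_Asymp.Real_Asymp"
begin

text \<open>
  For \<open>N\<close> points the density of the integral is \<open>exp (- K)\<close>, up to lower order, where \<open>K\<close> is the sum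
  of the kernel over all pairs of distinct points; it remains to see that the minimum of \<open>K\<close> is
  \<open>N\<^sup>2 E + O(N log N)\<close>. Averaging \<open>K\<close> over the \<open>N\<close>-th power of a nearly optimal measure bounds the
  minimum from above. For the bound from below, the points of a configuration, taken in increasing
  order (and nonnegative if the roots \<open>a\<^sub>i + a\<^sub>j\<close> are present), are smeared over successive intervals
  of length \<open>N^(-3)\<close>, shifted so that no gap between two points shrinks. As \<open>ln \<bar>sinh x\<bar>\<close> increases
  with \<open>\<bar>x\<bar>\<close>, only the quadratic potential can increase, and the self-interaction of an interval is
  \<open>O(log N)\<close>, so the energy of the smeared measure exceeds \<open>K / N\<^sup>2\<close> by little.
  The same shifts give a box of volume \<open>N^(-3N)\<close> around a near-minimiser on which the density is almost maximal, which
  bounds the integral from below; the bound from above follows from coercivity of \<open>K\<close>.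
\<close>

text \<open>The diagonal carries infinite energy, so a configuration cannot be inserted into the
  functional as a sum of point masses; this forces the smearing. Conversely, only nearly optimal
  measures enter, so the existence of a minimising measure never has to be discussed. All families
  are treated as one gas, but the rank fits them differently. \<open>K\<close> contains N - 1 copies
  of the potential, while t = r \<sigma>^2 puts the factor r in front of it. For type A there are N
  = r + 1 points and the two agree; for the other types N = r and one further copy has to be carried
  along. Type A brings another obstacle: its points lie on a hyperplane, so they cannot all be
  shifted to the right. There the interaction sees only gaps, so most points may move left instead.
  All estimates hold at finite N with the explicit error scale \<open>err N\<close>; a single
  division by r^2 at the end yields every limit.\<close>

section \<open>Elementary bounds for \<open>ln \<bar>sinh x\<bar>\<close>\<close>

definition ls :: "real \<Rightarrow> real" where
  "ls x = ln \<bar>sinh x\<bar>"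

lemma ls_minus [simp]: "ls (- x) = ls x"
  by (simp add: ls_def)

lemma ls_minus_commute: "ls (x - y) = ls (y - x)"
  by (metis ls_minus minus_diff_eq)

lemma borel_measurable_sinh [measurable (raw)]:
  fixes f :: "'a \<Rightarrow> real"
  assumes "f \<in> borel_measurable M"
  shows "(\<lambda>x. sinh (f x)) \<in> borel_measurable M"
proof -
  have "(sinh :: real \<Rightarrow> real) \<in> borel_measurable borel"
    by (intro borel_measurable_continuous_onI continuous_intros)
  then show ?thesis using assms by (rule measurable_compose[rotated])
qed

lemma measurable_ls [measurable]: "ls \<in> borel_measurable borel"
  unfolding ls_def by measurable

lemma abs_sinh: "\<bar>sinh x\<bar> = sinh \<bar>x\<bar>" for x :: real
  by simp

lemma abs_sinh_le_exp: "\<bar>sinh x\<bar> \<le> exp \<bar>x\<bar>" for x :: real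
proof -
  have "sinh y = (exp y - exp (- y)) / 2" for y :: real by (simp add: sinh_field_def)
  moreover have "(a - b) / 2 \<le> a" if "a > 0" "b > 0" for a b :: real
    using that by (simp add: field_simps)
  ultimately show ?thesis by (metis abs_sinh exp_gt_zero)
qed

lemma ls_le_abs: "ls x \<le> \<bar>x\<bar>"
proof (cases "x = 0")
  case False
  then have "\<bar>sinh x\<bar> > 0" by simp
  then have "ls x \<le> ln (exp \<bar>x\<bar>)"
    unfolding ls_def using abs_sinh_le_exp[of x] by (subst ln_le_cancel_iff) auto
  then show ?thesis by simp
qed (simp add: ls_def)

text \<open>\<open>ls 0 = 0\<close> because \<open>ln 0 = 0\<close>, and this exceeds
  \<open>ls y\<close> for small nonzero \<open>y\<close>; hence the hypothesis that \<open>x\<close>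
  is nonzero.\<close>

lemma ls_mono:
  assumes "0 < \<bar>x\<bar>" "\<bar>x\<bar> \<le> \<bar>y\<bar>"
  shows "ls x \<le> ls y"
proof -
  have "\<bar>sinh x\<bar> > 0" "\<bar>sinh x\<bar> \<le> \<bar>sinh y\<bar>"
    using assms by (auto simp: abs_sinh simp del: sinh_real_abs)
  then show ?thesis unfolding ls_def by (subst ln_le_cancel_iff) auto
qed

lemma le_sinh: "x \<le> sinh x" if "x \<ge> 0" for x :: real
proof -
  have "sinh 0 - 0 \<le> sinh x - x"
    by (rule DERIV_nonneg_imp_nondecreasing[OF that])
       (auto intro!: exI derivative_eq_intros cosh_real_ge_1)
  then show ?thesis by simp
qed

text \<open>Compares the singularity of \<open>ls\<close> at 0 with the integrable one of
  \<open>ln\<close>; at 0 itself both sides take the default value 0.\<close>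

lemma ln_le_ls: "ln \<bar>x\<bar> \<le> ls x"
proof (cases "x = 0")
  case False
  then show ?thesis
    unfolding ls_def
      using le_sinh[of "\<bar>x\<bar>"] by (subst ln_le_cancel_iff) (auto simp: abs_sinh simp del: sinh_real_abs)
qed (simp add: ls_def)

section \<open>Sums over ordered pairs of distinct indices\<close>

lemma sum_pairs_eq_sum_lower:
  fixes f :: "nat \<Rightarrow> nat \<Rightarrow> real"
  assumes "\<And>i j. f i j = f j i"
  shows "(\<Sum>i<N. \<Sum>j\<in>{..<N}-{i}. f i j) = 2 * (\<Sum>j<N. \<Sum>i<j. f i j)"
proof (induction N)
  case (Suc N)
  have "(\<Sum>i<Suc N. \<Sum>j\<in>{..<Suc N}-{i}. f i j)
      = (\<Sum>i<N. \<Sum>j\<in>{..<Suc N}-{i}. f i j) + (\<Sum>j<N. f N j)"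
    by (simp add: lessThan_Suc)
  also have "(\<Sum>i<N. \<Sum>j\<in>{..<Suc N}-{i}. f i j) = (\<Sum>i<N. f i N + (\<Sum>j\<in>{..<N}-{i}. f i j))"
  proof (rule sum.cong[OF refl])
    fix i assume "i \<in> {..<N}"
    then have "{..<Suc N} - {i} = insert N ({..<N} - {i})" by auto
    then show "(\<Sum>j\<in>{..<Suc N}-{i}. f i j) = f i N + (\<Sum>j\<in>{..<N}-{i}. f i j)" by simp
  qed
  also have "(\<Sum>j<N. f N j) = (\<Sum>i<N. f i N)"
    using assms by simp
  finally show ?case using Suc by (simp add: sum.distrib)
qed simp

lemma sum_pairs_const: "(\<Sum>i<N. \<Sum>j\<in>{..<N}-{i}. c) = real N * real (N - 1) * c" for c :: real
  by (cases N) (auto simp: algebra_simps)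

lemma sum_pairs_fst: "(\<Sum>i<N. \<Sum>j\<in>{..<N}-{i}. f i) = real (N - 1) * (\<Sum>i<N. f i)" for f :: "nat \<Rightarrow> real"
  by (simp add: sum_distrib_left)

lemma sum_pairs_snd: "(\<Sum>i<N. \<Sum>j\<in>{..<N}-{i}. f j) = real (N - 1) * (\<Sum>i<N. f i)" for f :: "nat \<Rightarrow> real"
proof -
  have "(\<Sum>i<N. \<Sum>j\<in>{..<N}-{i}. f j) = (\<Sum>i<N. (\<Sum>j<N. f j) - f i)"
    by (intro sum.cong refl) (simp add: sum_diff1)
  also have "\<dots> = real N * (\<Sum>j<N. f j) - (\<Sum>j<N. f j)"
    by (simp add: sum_subtractf)
  also have "\<dots> = real (N - 1) * (\<Sum>i<N. f i)"
    by (cases N) (auto simp: algebra_simps)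
  finally show ?thesis .
qed

subsection \<open>The interaction kernel\<close>

text \<open>The instances have q = c / (2 t) and \<kappa> = \<beta> (\<delta> - 1); \<open>s\<close>
  says whether the roots a_i + a_j occur, so it is false for type A only. A nonzero \<kappa> is tied
  to \<open>s\<close> because \<open>ls x\<close> increases to the right only for positive x, and
  only the reflection symmetry that comes with \<open>s\<close> allows the points to be taken
  nonnegative.\<close>

locale log_gas =
  fixes q \<beta> \<kappa> :: real and s :: bool
  assumes q_pos: "q > 0" and beta_pos: "\<beta> > 0" and kappa_nonneg: "\<kappa> \<ge> 0"
    and kappa_zero: "\<not> s \<Longrightarrow> \<kappa> = 0"
begin

definition V :: "real \<Rightarrow> real" where
  "V x = q * x\<^sup>2 - \<kappa> * ls x"

definition L :: "real \<Rightarrow> real \<Rightarrow> real" where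
  "L x y = ls (x - y) + (if s then ls (x + y) else 0)"

definition k :: "real \<Rightarrow> real \<Rightarrow> real" where
  "k x y = V x / 2 + V y / 2 - \<beta> / 2 * L x y"

text \<open>Where this fails, the true kernel is infinite but the real-valued \<open>k\<close> is
  not, since \<open>ls 0 = 0\<close>. The last clause depends on \<kappa> because 0 times infinity
  is 0 in \<open>ereal\<close>.\<close>

definition nonsing :: "real \<Rightarrow> real \<Rightarrow> bool" where
  "nonsing x y \<longleftrightarrow> x \<noteq> y \<and> (s \<longrightarrow> x + y \<noteq> 0) \<and> (\<kappa> \<noteq> 0 \<longrightarrow> x \<noteq> 0 \<and> y \<noteq> 0)"

definition k_ext :: "real \<Rightarrow> real \<Rightarrow> ereal" where
  "k_ext x y = ereal (1 / 2) * (ereal (q * x\<^sup>2) - ereal \<kappa> * log_sinh x)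
     + ereal (1 / 2) * (ereal (q * y\<^sup>2) - ereal \<kappa> * log_sinh y)
     - ereal (\<beta> / 2) * (log_sinh (x - y) + (if s then log_sinh (x + y) else 0))"

text \<open>Twice the cost b^2 / q of \<open>quadratic_ge\<close> at p = q / 2, where b = \<kappa> /
  2 + \<beta> is the linear growth rate, per point, of the logarithmic terms in
  \<open>k\<close>.\<close>

definition B :: real where
  "B = 2 * (\<kappa> / 2 + \<beta>)\<^sup>2 / q"

lemma B_nonneg: "B \<ge> 0"
  using q_pos by (simp add: B_def)

lemma k_ext_eq: "k_ext x y = (if nonsing x y then ereal (k x y) else \<infinity>)"
  using kappa_nonneg beta_pos
  by (auto simp: k_ext_def k_def V_def L_def nonsing_def log_sinh_def ls_def algebra_simps
      zero_ereal_def[symmetric] add_divide_distrib diff_divide_distrib)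

lemma V_ge: "V x \<ge> q * x\<^sup>2 - \<kappa> * \<bar>x\<bar>"
  using kappa_nonneg ls_le_abs[of x] by (simp add: V_def mult_left_mono)

text \<open>Completes the square but keeps half of the quadratic term, which later provides
  coercivity and Gaussian decay.\<close>

lemma quadratic_ge: "p * x\<^sup>2 - b * \<bar>x\<bar> \<ge> p / 2 * x\<^sup>2 - b\<^sup>2 / (2 * p)" if "p > 0" for p b x :: real
proof -
  have "0 \<le> (p * \<bar>x\<bar> - b)\<^sup>2 / (2 * p)" using that by simp
  also have "\<dots> = p / 2 * x\<^sup>2 - b * \<bar>x\<bar> + b\<^sup>2 / (2 * p)"
    using that by (simp add: power2_diff field_simps power2_eq_square)
  finally show ?thesis by (simp add: field_simps)
qed

lemma L_le: "L x y \<le> 2 * \<bar>x\<bar> + 2 * \<bar>y\<bar>"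
  using ls_le_abs[of "x - y"] ls_le_abs[of "x + y"] by (auto simp: L_def)

lemma k_ge: "k x y \<ge> q / 4 * (x\<^sup>2 + y\<^sup>2) - B"
proof -
  let ?b = "\<kappa> / 2 + \<beta>"
  have 1: "q / 2 * z\<^sup>2 - ?b * \<bar>z\<bar> \<ge> q / 4 * z\<^sup>2 - ?b\<^sup>2 / q" for z
    using quadratic_ge[of "q / 2" z ?b] q_pos by simp
  have "k x y \<ge> (q * x\<^sup>2 - \<kappa> * \<bar>x\<bar>) / 2 + (q * y\<^sup>2 - \<kappa> * \<bar>y\<bar>) / 2 - \<beta> / 2 * (2 * \<bar>x\<bar> + 2 * \<bar>y\<bar>)"
    unfolding k_def using V_ge[of x] V_ge[of y] L_le[of x y] beta_pos
    by (intro diff_mono add_mono divide_right_mono mult_left_mono) auto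
  also have "(q * x\<^sup>2 - \<kappa> * \<bar>x\<bar>) / 2 + (q * y\<^sup>2 - \<kappa> * \<bar>y\<bar>) / 2 - \<beta> / 2 * (2 * \<bar>x\<bar> + 2 * \<bar>y\<bar>)
    = (q / 2 * x\<^sup>2 - ?b * \<bar>x\<bar>) + (q / 2 * y\<^sup>2 - ?b * \<bar>y\<bar>)"
    by (simp add: algebra_simps add_divide_distrib diff_divide_distrib)
  finally have "k x y \<ge> (q / 4 * x\<^sup>2 - ?b\<^sup>2 / q) + (q / 4 * y\<^sup>2 - ?b\<^sup>2 / q)"
    using 1[of x] 1[of y] by linarith
  then show ?thesis by (simp add: B_def algebra_simps)
qed

lemma k_nonneg: "0 \<le> k x y + B"
proof -
  have "0 \<le> q / 4 * (x\<^sup>2 + y\<^sup>2)" using q_pos by simp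
  then show ?thesis using k_ge[of x y] by linarith
qed

lemma k_commute: "k x y = k y x"
  using ls_minus_commute[of x y] by (simp add: k_def L_def add.commute)

text \<open>A change of sign exchanges x - y and x + y up to sign, and \<open>ls\<close> is even:
  this is the sign-change symmetry of the Weyl group.\<close>

lemma k_abs: "s \<Longrightarrow> k \<bar>x\<bar> \<bar>y\<bar> = k x y"
proof -
  have "ls \<bar>z\<bar> = ls z" for z by (auto simp: abs_if)
  moreover have "ls (\<bar>x\<bar> - \<bar>y\<bar>) + ls (\<bar>x\<bar> + \<bar>y\<bar>) = ls (x - y) + ls (x + y)"
    using ls_minus[of "x + y"] ls_minus[of "x - y"]
      by (auto simp: abs_if algebra_simps simp del: ls_minus)
  moreover assume s
  ultimately show ?thesis unfolding k_def L_def V_def by simp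
qed

text \<open>The shift by \<open>B\<close> makes the kernel nonnegative, so that nonnegative
  integrals and Tonelli apply; singular pairs get their true value instead of the default of
  \<open>ln\<close>.\<close>

definition k_hat :: "real \<Rightarrow> real \<Rightarrow> ennreal" where
  "k_hat x y = (if nonsing x y then ennreal (k x y + B) else \<infinity>)"

lemma measurable_k [measurable]:
  "(\<lambda>z. k (fst z) (snd z)) \<in> borel_measurable (borel \<Otimes>\<^sub>M borel)"
  unfolding k_def V_def L_def by measurable

lemma measurable_nonsing [measurable]:
  "Measurable.pred (borel \<Otimes>\<^sub>M borel) (\<lambda>z. nonsing (fst z) (snd z))"
  unfolding nonsing_def by measurable

lemma measurable_k_hat [measurable]:
  "(\<lambda>z. k_hat (fst z) (snd z)) \<in> borel_measurable (borel \<Otimes>\<^sub>M borel)"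
  unfolding k_hat_def by measurable

definition I :: "real measure \<Rightarrow> ereal" where
  "I \<mu> = energy \<beta> (\<lambda>x. ereal (q * x\<^sup>2) - ereal \<kappa> * log_sinh x)
     (\<lambda>x y. log_sinh (x - y) + (if s then log_sinh (x + y) else 0)) \<mu>"

text \<open>The negative part of the kernel is at most \<open>B\<close>, so the difference in
  \<open>ereal_integral\<close> is never of the form \<infinity> - \<infinity> and the constant can
  be taken out.\<close>

lemma I_eq:
  assumes "\<mu> \<in> borel_prob_measures"
  shows "I \<mu> = enn2ereal (\<integral>\<^sup>+x. \<integral>\<^sup>+y. k_hat x y \<partial>\<mu> \<partial>\<mu>) - ereal B"
proof -
  interpret prob_space \<mu> using assms by (simp add: borel_prob_measures_def)
  interpret P: pair_prob_space \<mu> \<mu> ..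
  have [measurable_cong]: "sets \<mu> = sets borel" using assms by (simp add: borel_prob_measures_def)
  let ?M = "\<mu> \<Otimes>\<^sub>M \<mu>"
  let ?f = "\<lambda>z. k_ext (fst z) (snd z)"
  have [measurable]: "?f \<in> borel_measurable (borel \<Otimes>\<^sub>M borel)"
    unfolding k_ext_eq by measurable
  let ?p = "\<integral>\<^sup>+z. e2ennreal (?f z) \<partial>?M" and ?n = "\<integral>\<^sup>+z. e2ennreal (- ?f z) \<partial>?M"
  \<comment> \<open>With f the kernel: f^+ + B = (f + B) + f^-, which is free of subtractions and
    can be integrated in \<open>ennreal\<close>.\<close>
  have pw: "e2ennreal (?f z) + ennreal B = k_hat (fst z) (snd z) + e2ennreal (- ?f z)"
    and neg: "e2ennreal (- ?f z) \<le> ennreal B" for z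
  proof -
    let ?k = "k (fst z) (snd z)"
    have "ennreal ?k + ennreal B = ennreal (?k + B) + ennreal (- ?k)"
      using B_nonneg k_nonneg[of "fst z" "snd z"]
      by (cases "?k \<ge> 0") (simp_all add: ennreal_plus[symmetric] ennreal_neg del: ennreal_plus)
    then show "e2ennreal (?f z) + ennreal B = k_hat (fst z) (snd z) + e2ennreal (- ?f z)"
      by (auto simp: k_ext_eq k_hat_def e2ennreal_infty e2ennreal_ereal)
    show "e2ennreal (- ?f z) \<le> ennreal B"
      using B_nonneg k_nonneg[of "fst z" "snd z"]
      by (auto simp: k_ext_eq e2ennreal_ereal e2ennreal_neg intro!: ennreal_leI)
  qed
  have "?n \<le> (\<integral>\<^sup>+z. ennreal B \<partial>?M)" by (intro nn_integral_mono neg)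
  also have "\<dots> = ennreal B" by (simp add: P.P.emeasure_space_1 nn_integral_const)
  finally have n: "?n \<le> ennreal B" .
  have "(\<integral>\<^sup>+z. e2ennreal (?f z) + ennreal B \<partial>?M) = (\<integral>\<^sup>+z. k_hat (fst z) (snd z) + e2ennreal (- ?f z) \<partial>?M)"
    by (simp only: pw)
  then have "?p + ennreal B = (\<integral>\<^sup>+z. k_hat (fst z) (snd z) \<partial>?M) + ?n"
    by (simp add: nn_integral_add P.P.emeasure_space_1)
  moreover have "(\<integral>\<^sup>+z. k_hat (fst z) (snd z) \<partial>?M) = (\<integral>\<^sup>+x. \<integral>\<^sup>+y. k_hat x y \<partial>\<mu> \<partial>\<mu>)"
    by (subst nn_integral_fst[symmetric]) simp_all
  ultimately have eq: "?p + ennreal B = (\<integral>\<^sup>+x. \<integral>\<^sup>+y. k_hat x y \<partial>\<mu> \<partial>\<mu>) + ?n" (is "_ = ?K + _")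
    by simp
  have "I \<mu> = enn2ereal ?p - enn2ereal ?n"
    by (simp add: I_def energy_def ereal_integral_def k_ext_def[symmetric] case_prod_beta')
  moreover have "enn2ereal ?p + ereal B = enn2ereal ?K + enn2ereal ?n"
    using arg_cong[OF eq, of enn2ereal] B_nonneg
      by (simp add: plus_ennreal.rep_eq enn2ereal_ennreal)
  moreover obtain m where "enn2ereal ?n = ereal m"
    using n by (cases "?n") (auto simp: enn2ereal_ennreal top_unique)
  ultimately show ?thesis
    by (cases "enn2ereal ?p"; cases "enn2ereal ?K") auto
qed

end

subsection \<open>Configurations and averaging\<close>

text \<open>The joint law of two coordinates is the product of \<mu> with itself: integrate over {j,
  i} one coordinate at a time, then pull back along restriction. This averages a pair sum term by
  term.\<close>

lemma nn_integral_PiM_pair: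
  assumes "prob_space \<mu>" "finite A" "i \<in> A" "j \<in> A" "i \<noteq> j"
    and [measurable]: "(\<lambda>z. f (fst z) (snd z)) \<in> borel_measurable (\<mu> \<Otimes>\<^sub>M \<mu>)"
  shows "(\<integral>\<^sup>+x. f (x i) (x j) \<partial>(\<Pi>\<^sub>M _\<in>A. \<mu>)) = (\<integral>\<^sup>+x. \<integral>\<^sup>+y. f x y \<partial>\<mu> \<partial>\<mu>)"
proof -
  interpret prob_space \<mu> by fact
  interpret P: product_prob_space "\<lambda>_. \<mu>" A by unfold_locales
  have m: "(\<lambda>x. f (x i) (x j)) \<in> borel_measurable (PiM {j, i} (\<lambda>_. \<mu>))"
    using measurable_compose[of "\<lambda>x. (x i, x j)" "PiM {j, i} (\<lambda>_. \<mu>)" "\<mu> \<Otimes>\<^sub>M \<mu>" "\<lambda>z. f (fst z) (snd z)"]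
    by simp
  have m1: "(\<lambda>x. \<integral>\<^sup>+y. f x y \<partial>\<mu>) \<in> borel_measurable \<mu>"
    using borel_measurable_nn_integral_fst[of "\<lambda>z. f (fst z) (snd z)" \<mu>] by simp
  have "(\<integral>\<^sup>+x. \<integral>\<^sup>+y. f x y \<partial>\<mu> \<partial>\<mu>) = (\<integral>\<^sup>+x. (\<integral>\<^sup>+y. f (x i) y \<partial>\<mu>) \<partial>(PiM {i} (\<lambda>_. \<mu>)))"
    using P.product_nn_integral_singleton[of "\<lambda>x. \<integral>\<^sup>+y. f x y \<partial>\<mu>" i] m1 by simp
  also have "\<dots> = (\<integral>\<^sup>+x. f (x i) (x j) \<partial>(PiM {j, i} (\<lambda>_. \<mu>)))"
    using P.product_nn_integral_insert[of "{i}" j "\<lambda>x. f (x i) (x j)"] m assms(5) by simp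
  also have "PiM {j, i} (\<lambda>_. \<mu>) = distr (PiM A (\<lambda>_. \<mu>)) (PiM {j, i} (\<lambda>_. \<mu>)) (\<lambda>x. restrict x {j, i})"
    using P.distr_PiM_restrict_finite[of "{j, i}"] assms by simp
  also have "(\<integral>\<^sup>+x. f (x i) (x j) \<partial>\<dots>) = (\<integral>\<^sup>+x. f (x i) (x j) \<partial>(PiM A (\<lambda>_. \<mu>)))"
    using assms m by (subst nn_integral_distr) (auto intro!: measurable_restrict_subset)
  finally show ?thesis by simp
qed

lemma sum_pairs_reindex:
  assumes "inj_on f A"
  shows "(\<Sum>i\<in>A. \<Sum>j\<in>A-{i}. g (f i) (f j)) = (\<Sum>u\<in>f ` A. \<Sum>v\<in>f ` A - {u}. g u v)"
proof -
  have "(\<Sum>u\<in>f ` A. \<Sum>v\<in>f ` A - {u}. g u v) = (\<Sum>i\<in>A. \<Sum>v\<in>f ` A - {f i}. g (f i) v)"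
    by (simp add: sum.reindex[OF assms])
  also have "\<dots> = (\<Sum>i\<in>A. \<Sum>j\<in>A-{i}. g (f i) (f j))"
  proof (rule sum.cong[OF refl])
    fix i assume i: "i \<in> A"
    have "f ` A - {f i} = f ` (A - {i})"
      using inj_on_image_set_diff[OF assms, of A "{i}"] i by auto
    moreover have "inj_on f (A - {i})" using assms by (rule inj_on_subset) auto
    ultimately show "(\<Sum>v\<in>f ` A - {f i}. g (f i) v) = (\<Sum>j\<in>A-{i}. g (f i) (f j))"
      by (simp add: sum.reindex)
  qed
  finally show ?thesis by simp
qed

context log_gas
begin

definition K :: "nat \<Rightarrow> (nat \<Rightarrow> real) \<Rightarrow> real" where
  "K N x = (\<Sum>i<N. \<Sum>j\<in>{..<N}-{i}. k (x i) (x j))"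

definition good :: "nat \<Rightarrow> (nat \<Rightarrow> real) \<Rightarrow> bool" where
  "good N x \<longleftrightarrow> (\<forall>i<N. \<forall>j<N. i \<noteq> j \<longrightarrow> nonsing (x i) (x j))"

text \<open>The first point may be 0 if \<kappa> = 0: with all points distinct and nonnegative, no
  sum of two of them vanishes.\<close>

definition config :: "nat \<Rightarrow> (nat \<Rightarrow> real) \<Rightarrow> bool" where
  "config N x \<longleftrightarrow> (\<forall>i j. i < j \<longrightarrow> j < N \<longrightarrow> x i < x j) \<and>
     (s \<longrightarrow> (\<forall>i<N. 0 \<le> x i)) \<and> (\<kappa> \<noteq> 0 \<longrightarrow> (\<forall>i<N. x i \<noteq> 0))"

text \<open>Each point occurs in 2 (N - 1) ordered pairs, which turns the q / 4 of
  \<open>k_ge\<close> into q / 2.\<close>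

lemma K_coercive: "K N x \<ge> real (N - 1) * (q / 2 * (\<Sum>i<N. (x i)\<^sup>2) - real N * B)"
proof -
  have "(\<Sum>i<N. \<Sum>j\<in>{..<N}-{i}. q / 4 * (x i)\<^sup>2 + (q / 4 * (x j)\<^sup>2 - B)) \<le> K N x"
    unfolding K_def by (intro sum_mono order_trans[OF _ k_ge]) (simp add: algebra_simps)
  moreover have "(\<Sum>i<N. \<Sum>j\<in>{..<N}-{i}. q / 4 * (x i)\<^sup>2 + (q / 4 * (x j)\<^sup>2 - B))
    = real (N - 1) * (\<Sum>i<N. q / 4 * (x i)\<^sup>2) + real (N - 1) * (\<Sum>i<N. q / 4 * (x i)\<^sup>2 - B)"
    unfolding sum.distrib sum_pairs_fst sum_pairs_snd ..
  moreover have "(\<Sum>i<N. q * (x i)\<^sup>2 / 4) = q * (\<Sum>i<N. (x i)\<^sup>2) / 4"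
    by (simp add: sum_distrib_left sum_divide_distrib)
  ultimately show ?thesis
    by (simp add: sum_subtractf right_diff_distrib mult.left_commute)
qed

text \<open>\<open>K\<close> is invariant under permutations and, if \<open>s\<close> holds, under
  sign changes; so absolute values may be taken and the points sorted.\<close>

lemma good_imp_config:
  assumes "good N x" "N \<ge> 2"
  obtains y where "config N y" "K N y = K N x"
proof -
  define z where "z i = (if s then \<bar>x i\<bar> else x i)" for i
  have ns: "nonsing (x i) (x j)" if "i < N" "j < N" "i \<noteq> j" for i j
    using assms(1) that by (auto simp: good_def)
  have inj: "inj_on z {..<N}"
  proof (rule inj_onI, rule ccontr)
    fix i j assume *: "i \<in> {..<N}" "j \<in> {..<N}" "z i = z j" "i \<noteq> j"
    then have "x i \<noteq> x j \<and> (s \<longrightarrow> x i + x j \<noteq> 0)" using ns[of i j] unfolding nonsing_def by auto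
    with *(3) show False by (auto simp: z_def abs_eq_iff split: if_splits)
  qed
  have z0: "z i \<noteq> 0" if "\<kappa> \<noteq> 0" "i < N" for i
  proof -
    \<comment> \<open>\<open>nonsing\<close> constrains a point only as a member of a pair, so a
      partner index is chosen; it exists as \<open>N \<ge> 2\<close>.\<close>
    have "nonsing (x i) (x (if i = 0 then 1 else 0))"
      using ns[of i "if i = 0 then 1 else 0"] that assms(2) by auto
    then show ?thesis using that by (auto simp: nonsing_def z_def)
  qed
  define A where "A = z ` {..<N}"
  define y where "y = (!) (sorted_list_of_set A)"
  have fin: "finite A" and card: "card A = N" using inj by (auto simp: A_def card_image)
  have len: "length (sorted_list_of_set A) = N" by (simp add: card)
  have less: "y i < y j" if "i < j" "j < N" for i j
    unfolding y_def using that len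
    by (intro sorted_wrt_nth_less[OF strict_sorted_list_of_set]) auto
  have img: "y ` {..<N} = A"
  proof -
    have "A = set (sorted_list_of_set A)" using fin by simp
    also have "\<dots> = y ` {..<N}" unfolding set_conv_nth len y_def by auto
    finally show ?thesis by simp
  qed
  have "inj_on y {..<N}"
    using less by (intro inj_onI) (metis lessThan_iff less_irrefl nat_neq_iff)
  then have "K N y = (\<Sum>u\<in>A. \<Sum>v\<in>A - {u}. k u v)"
    unfolding K_def using sum_pairs_reindex[of y "{..<N}" k] img by simp
  also have "\<dots> = K N z"
    unfolding K_def using sum_pairs_reindex[OF inj, of k] by (simp add: A_def)
  also have "\<dots> = K N x"
  proof -
    have "k (z i) (z j) = k (x i) (x j)" for i j
    proof (cases s)
      case True
      show ?thesis using k_abs[OF True, of "x i" "x j"] unfolding z_def if_P[OF True] .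
    qed (simp add: z_def)
    then show ?thesis by (simp add: K_def)
  qed
  finally have "K N y = K N x" .
  moreover have yz: "\<exists>l<N. y i = z l" if "i < N" for i
    using img that unfolding A_def by blast
  have "0 \<le> y i" if s "i < N" for i
    using yz[of i] that by (auto simp: z_def)
  moreover have "y i \<noteq> 0" if "\<kappa> \<noteq> 0" "i < N" for i
    using yz[of i] z0 that by metis
  ultimately have "config N y" "K N y = K N x"
    unfolding config_def using less by auto
  then show ?thesis using that by blast
qed

text \<open>First moment method: for independent points of law \<mu> the mean of \<open>K\<close> is
  N (N - 1) times the energy, so not every configuration can exceed N (N - 1) e.\<close>

lemma exists_config_le:
  assumes \<mu>: "\<mu> \<in> borel_prob_measures" and I: "I \<mu> < ereal e" and N: "N \<ge> 2"
  obtains x where "config N x" "K N x \<le> real N * real (N - 1) * e"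
proof -
  interpret prob_space \<mu> using \<mu> by (simp add: borel_prob_measures_def)
  interpret P: product_prob_space "\<lambda>_::nat. \<mu>" "{..<N}" by unfold_locales
  have [measurable_cong]: "sets \<mu> = sets borel" using \<mu> by (simp add: borel_prob_measures_def)
  let ?J = "\<integral>\<^sup>+x. \<integral>\<^sup>+y. k_hat x y \<partial>\<mu> \<partial>\<mu>"
  have J: "enn2ereal ?J < ereal (e + B)"
    using I unfolding I_eq[OF \<mu>] by (cases "enn2ereal ?J") auto
  then have "0 < ereal (e + B)" using enn2ereal_nonneg le_less_trans by blast
  then have eB: "e + B > 0" by simp
  have J': "?J < ennreal (e + B)"
    using J eB by (simp add: less_ennreal.rep_eq enn2ereal_ennreal)
  have "\<exists>x. good N x \<and> K N x \<le> real N * real (N - 1) * e"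
  proof (rule ccontr)
    assume "\<not> ?thesis"
    then have *: "K N x > real N * real (N - 1) * e" if "good N x" for x
      using that by force
    have ge: "ennreal (real N * real (N - 1) * (e + B)) \<le> (\<Sum>i<N. \<Sum>j\<in>{..<N}-{i}. k_hat (x i) (x j))" for x
    proof (cases "good N x")
      case True
      have "real N * real (N - 1) * (e + B) \<le> K N x + real N * real (N - 1) * B"
        using *[OF True] by (simp add: algebra_simps)
      also have "\<dots> = (\<Sum>i<N. \<Sum>j\<in>{..<N}-{i}. k (x i) (x j) + B)"
        unfolding K_def sum.distrib sum_pairs_const ..
      finally have "ennreal (real N * real (N - 1) * (e + B)) \<le> ennreal (\<Sum>i<N. \<Sum>j\<in>{..<N}-{i}. k (x i) (x j) + B)"
        by (rule ennreal_leI)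
      also have "\<dots> = (\<Sum>i<N. \<Sum>j\<in>{..<N}-{i}. ennreal (k (x i) (x j) + B))"
        by (simp add: sum_nonneg k_nonneg)
      also have "\<dots> = (\<Sum>i<N. \<Sum>j\<in>{..<N}-{i}. k_hat (x i) (x j))"
        using True by (intro sum.cong refl) (auto simp: k_hat_def good_def)
      finally show ?thesis .
    next
      case False
      \<comment> \<open>A singular pair makes the shifted sum infinite, so the inequality holds here
        too and no null set has to be split off.\<close>
      then obtain i j where "i < N" "j < N" "i \<noteq> j" "\<not> nonsing (x i) (x j)"
        by (auto simp: good_def)
      then have "(\<Sum>j\<in>{..<N}-{i}. k_hat (x i) (x j)) = \<infinity>"
        by (auto simp: k_hat_def)
      then have "(\<Sum>i<N. \<Sum>j\<in>{..<N}-{i}. k_hat (x i) (x j)) = \<infinity>"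
        using \<open>i < N\<close> by auto
      then show ?thesis unfolding infinity_ennreal_def by (simp only: top_greatest)
    qed
    have "ennreal (real N * real (N - 1) * (e + B))
        = (\<integral>\<^sup>+x. ennreal (real N * real (N - 1) * (e + B)) \<partial>(\<Pi>\<^sub>M _\<in>{..<N}. \<mu>))"
      by (simp add: P.emeasure_space_1)
    also have "\<dots> \<le> (\<integral>\<^sup>+x. (\<Sum>i<N. \<Sum>j\<in>{..<N}-{i}. k_hat (x i) (x j)) \<partial>(\<Pi>\<^sub>M _\<in>{..<N}. \<mu>))"
      by (intro nn_integral_mono ge)
    also have "\<dots> = (\<Sum>i<N. \<Sum>j\<in>{..<N}-{i}. \<integral>\<^sup>+x. k_hat (x i) (x j) \<partial>(\<Pi>\<^sub>M _\<in>{..<N}. \<mu>))"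
    proof -
      have m: "(\<lambda>x. k_hat (x i) (x j)) \<in> borel_measurable (\<Pi>\<^sub>M _\<in>{..<N}. \<mu>)"
        if "i \<in> {..<N}" "j \<in> {..<N}" for i j
        using that measurable_compose[of "\<lambda>x. (x i, x j)" "\<Pi>\<^sub>M _\<in>{..<N}. \<mu>" "\<mu> \<Otimes>\<^sub>M \<mu>" "\<lambda>z. k_hat (fst z) (snd z)"]
        by simp
      then have "(\<integral>\<^sup>+x. (\<Sum>j\<in>{..<N}-{i}. k_hat (x i) (x j)) \<partial>(\<Pi>\<^sub>M _\<in>{..<N}. \<mu>))
          = (\<Sum>j\<in>{..<N}-{i}. \<integral>\<^sup>+x. k_hat (x i) (x j) \<partial>(\<Pi>\<^sub>M _\<in>{..<N}. \<mu>))" if "i \<in> {..<N}" for i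
        using that by (intro nn_integral_sum) auto
      then show ?thesis using m by (subst nn_integral_sum) (auto intro!: borel_measurable_sum)
    qed
    also have "\<dots> = (\<Sum>i<N. \<Sum>j\<in>{..<N}-{i}. ?J)"
      by (intro sum.cong refl nn_integral_PiM_pair) (auto intro: prob_space_axioms)
    also have "\<dots> = ennreal (real N * real (N - 1)) * ?J"
      using N by (simp add: ennreal_mult ennreal_of_nat_eq_real_of_nat mult.assoc)
    also have "\<dots> < ennreal (real N * real (N - 1)) * ennreal (e + B)"
      using J' N by (intro ennreal_mult_strict_left_mono) auto
    finally show False using N eB by (simp add: ennreal_mult[symmetric])
  qed
  then show ?thesis using good_imp_config[OF _ N] that by metis
qed

end

subsection \<open>Smeared configurations\<close>

lemma nn_integral_neg_ln:
  assumes "0 < h" "h \<le> 1"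
  shows "(\<integral>\<^sup>+z. ennreal (- ln z) * indicator {0<..<h} z \<partial>lborel) = ennreal (h - h * ln h)"
proof -
  define F :: "real \<Rightarrow> real" where "F z = z - z * ln z" for z
  have lim: "((F \<circ> real_of_ereal) \<longlongrightarrow> 0) (at_right (ereal 0))"
  proof -
    have "(F \<longlongrightarrow> 0) (at_right 0)" unfolding F_def by real_asymp
    then show ?thesis by (simp add: ereal_tendsto_simps1)
  qed
  have lim': "((F \<circ> real_of_ereal) \<longlongrightarrow> F h) (at_left (ereal h))"
  proof -
    have "isCont F h" unfolding F_def using assms by (intro continuous_intros) auto
    then have "(F \<longlongrightarrow> F h) (at_left h)" by (simp add: isCont_def filterlim_at_split)
    then show ?thesis by (simp add: ereal_tendsto_simps1)
  qed
  have d: "DERIV F z :> - ln z" if "ereal 0 < ereal z" "ereal z < ereal h" for z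
    unfolding F_def using that by (auto intro!: derivative_eq_intros)
  have c: "isCont (\<lambda>z. - ln z) z" if "ereal 0 < ereal z" "ereal z < ereal h" for z
    using that by (auto intro!: continuous_intros)
  have nn: "0 \<le> - ln z" if "0 < z" "z < h" for z using that assms by (simp add: ln_le_zero_iff)
  have AE: "AE z in lborel. ereal 0 < ereal z \<longrightarrow> ereal z < ereal h \<longrightarrow> 0 \<le> - ln z"
    using nn by auto
  note FTC = interval_integral_FTC_nonneg[OF _ d c AE lim lim'] 
  have "set_integrable lborel {0<..<h} (\<lambda>z. - ln z)"
    using FTC(1) assms by simp
  moreover have "(LBINT z:{0<..<h}. - ln z) = h - h * ln h"
    using FTC(2) assms by (simp add: interval_lebesgue_integral_def F_def)
  moreover have "(\<integral>\<^sup>+z. ennreal (- ln z) * indicator {0<..<h} z \<partial>lborel)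
     = (\<integral>\<^sup>+z. ennreal (indicator {0<..<h} z *\<^sub>R - ln z) \<partial>lborel)"
    by (intro nn_integral_cong) (auto simp: indicator_def)
  moreover have "(\<integral>\<^sup>+z. ennreal (indicator {0<..<h} z *\<^sub>R - ln z) \<partial>lborel)
     = ennreal (LBINT z. indicator {0<..<h} z *\<^sub>R - ln z)"
    using calculation(1) nn unfolding set_integrable_def
    by (intro nn_integral_eq_integral) (auto simp: indicator_def)
  ultimately show ?thesis
    unfolding set_lebesgue_integral_def by simp
qed

text \<open>The symmetric interval contains, up to endpoints, every interval of length
  \<open>h\<close> around \<open>a\<close>; the bound therefore serves all positions of
  \<open>a\<close> within a smearing interval.\<close>

lemma nn_integral_neg_ln_dist_le:
  assumes "0 < h" "h \<le> 1"
  shows "(\<integral>\<^sup>+b. ennreal (- ln \<bar>a - b\<bar>) * indicator {a - h<..<a + h} b \<partial>lborel) \<le> ennreal (2 * (h - h * ln h))"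
proof -
  let ?f = "\<lambda>z. ennreal (- ln z) * indicator {0<..<h} z"
  have "(\<integral>\<^sup>+b. ennreal (- ln \<bar>a - b\<bar>) * indicator {a - h<..<a + h} b \<partial>lborel)
      = (\<integral>\<^sup>+b. ?f (b - a) + ?f (a - b) \<partial>lborel)"
    by (intro nn_integral_cong) (auto simp: indicator_def abs_if)
  also have "\<dots> = (\<integral>\<^sup>+b. ?f (b - a) \<partial>lborel) + (\<integral>\<^sup>+b. ?f (a - b) \<partial>lborel)"
    by (intro nn_integral_add) auto
  also have "(\<integral>\<^sup>+b. ?f (b - a) \<partial>lborel) = (\<integral>\<^sup>+b. ?f b \<partial>lborel)"
    using nn_integral_real_affine[of ?f 1 "- a"] by simp
  also have "(\<integral>\<^sup>+b. ?f (a - b) \<partial>lborel) = (\<integral>\<^sup>+b. ?f b \<partial>lborel)"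
    using nn_integral_real_affine[of ?f "-1" "a"] by simp
  also have "(\<integral>\<^sup>+b. ?f b \<partial>lborel) + (\<integral>\<^sup>+b. ?f b \<partial>lborel) = ennreal (2 * (h - h * ln h))"
  proof -
    have "h * ln h \<le> h * 0" using assms by (intro mult_left_mono) auto
    then have "0 \<le> h - h * ln h" using assms by linarith
    then show ?thesis
      unfolding nn_integral_neg_ln[OF assms]
        by (simp only: ennreal_plus[symmetric]) (simp add: algebra_simps)
  qed
  finally show ?thesis by simp
qed

text \<open>Factor the difference of squares and trade \<bar>x\<bar> for x^2 + 1. The relative error
  1 / N is small enough to be summed over the N - 1 partners of each point.\<close>

lemma sq_shift_le:
  fixes a x :: real
  assumes "N \<ge> 1" "\<bar>a - x\<bar> \<le> 2 / real N"
  shows "a\<^sup>2 \<le> x\<^sup>2 + (2 * x\<^sup>2 + 6) / real N"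
proof -
  have "2 * \<bar>x\<bar> \<le> x\<^sup>2 + 1" 
    using zero_le_power2[of "\<bar>x\<bar> - 1"] by (simp add: power2_diff)
  moreover have "2 / real N \<le> 2" using assms by (simp add: field_simps)
  moreover have "\<bar>a + x\<bar> \<le> 2 * \<bar>x\<bar> + \<bar>a - x\<bar>" by linarith
  ultimately have "\<bar>a + x\<bar> \<le> x\<^sup>2 + 3" using assms by linarith
  then have "\<bar>a - x\<bar> * \<bar>a + x\<bar> \<le> 2 / real N * (x\<^sup>2 + 3)"
    using assms by (intro mult_mono) auto
  moreover have "a\<^sup>2 - x\<^sup>2 \<le> \<bar>a - x\<bar> * \<bar>a + x\<bar>"
    by (simp add: abs_mult[symmetric] power2_eq_square algebra_simps) 
  ultimately show ?thesis by (simp add: algebra_simps add_divide_distrib)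
qed

corollary sq_shift_le':
  fixes a x :: real
  assumes "N \<ge> 1" "\<bar>a - x\<bar> \<le> 2 / real N"
  shows "a\<^sup>2 \<le> 3 * x\<^sup>2 + 6"
proof -
  have "(2 * x\<^sup>2 + 6) / real N \<le> (2 * x\<^sup>2 + 6) / 1"
    using assms by (intro divide_left_mono) auto
  then show ?thesis using sq_shift_le[OF assms] by simp
qed

context log_gas
begin

lemma k_mono:
  assumes "x < y" "y - x \<le> b - a" "s \<Longrightarrow> 0 \<le> x \<and> x \<le> a \<and> y \<le> b" "\<kappa> \<noteq> 0 \<Longrightarrow> x \<noteq> 0"
  shows "k a b \<le> k x y + q / 2 * (a\<^sup>2 - x\<^sup>2) + q / 2 * (b\<^sup>2 - y\<^sup>2)"
proof -
  have "V a \<le> V x + q * (a\<^sup>2 - x\<^sup>2)" and "V b \<le> V y + q * (b\<^sup>2 - y\<^sup>2)"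
  proof -
    have "\<kappa> * ls x \<le> \<kappa> * ls a" "\<kappa> * ls y \<le> \<kappa> * ls b"
    proof -
      have "ls x \<le> ls a \<and> ls y \<le> ls b" if "\<kappa> \<noteq> 0"
      proof -
        \<comment> \<open>A nonzero \<kappa> forces \<open>s\<close>, hence positive points: the
          one-body logarithms are on their increasing branch.\<close>
        have "s" using that kappa_zero by blast
        then have "0 < x" "x \<le> a" "y \<le> b" using assms that by force+
        then show ?thesis using assms(1) by (intro conjI ls_mono) auto
      qed
      then show "\<kappa> * ls x \<le> \<kappa> * ls a" "\<kappa> * ls y \<le> \<kappa> * ls b"
        using kappa_nonneg by (cases "\<kappa> = 0"; simp add: mult_left_mono)+
    qed
    then show "V a \<le> V x + q * (a\<^sup>2 - x\<^sup>2)" and "V b \<le> V y + q * (b\<^sup>2 - y\<^sup>2)"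
      by (simp_all add: V_def algebra_simps)
  qed
  moreover have "L x y \<le> L a b"
    unfolding L_def using assms by (intro add_mono ls_mono) (auto intro!: ls_mono)
  then have "\<beta> / 2 * L x y \<le> \<beta> / 2 * L a b" using beta_pos by simp
  ultimately show ?thesis by (simp add: k_def algebra_simps add_divide_distrib diff_divide_distrib)
qed

text \<open>The weight of the logarithm is \<beta> and not \<beta> / 2 because, if \<open>s\<close>
  holds, \<open>ls (a + b)\<close> is bounded below by the more singular \<open>ls (a - b)\<close>.
  If not, the doubled bound still holds since ln \<bar>a - b\<bar> is nonpositive.\<close>

lemma k_diagonal_le:
  assumes "a \<noteq> b" "\<bar>a - b\<bar> \<le> h" "h \<le> 1" "s \<Longrightarrow> h \<le> a \<and> h \<le> b" "0 < h"
  shows "k a b \<le> q / 2 * (a\<^sup>2 + b\<^sup>2) - \<kappa> * ln h + \<beta> * (- ln \<bar>a - b\<bar>)"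
proof -
  have V: "V z \<le> q * z\<^sup>2 - \<kappa> * ln h" if "s \<Longrightarrow> h \<le> z" for z
  proof (cases s)
    case True
    then have "h \<le> z" using that by simp
    then have "ln h \<le> ln \<bar>z\<bar>" using \<open>0 < h\<close> by (subst ln_le_cancel_iff) auto
    then have "ln h \<le> ls z" using ln_le_ls[of z] by simp
    then show ?thesis using kappa_nonneg by (simp add: V_def mult_left_mono)
  next
    case False
    then show ?thesis unfolding V_def using kappa_zero by simp
  qed
  have "L a b \<ge> 2 * ln \<bar>a - b\<bar>"
  proof (cases s)
    case True
    then have "ls (a - b) \<le> ls (a + b)" using assms by (intro ls_mono) auto
    then show ?thesis using ln_le_ls[of "a - b"] True unfolding L_def by simp
  next
    case False
    have "ln \<bar>a - b\<bar> \<le> 0" using assms by (simp add: ln_le_zero_iff)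
    then show ?thesis using ln_le_ls[of "a - b"] False unfolding L_def by simp
  qed
  then have "\<beta> / 2 * (2 * ln \<bar>a - b\<bar>) \<le> \<beta> / 2 * L a b" using beta_pos by (intro mult_left_mono) auto
  moreover have "V a \<le> q * a\<^sup>2 - \<kappa> * ln h" "V b \<le> q * b\<^sup>2 - \<kappa> * ln h" using V assms by auto
  ultimately show ?thesis by (simp add: k_def algebra_simps add_divide_distrib diff_divide_distrib)
qed

end

lemma sum_pairs_split: 
  fixes f :: "nat \<Rightarrow> 'a :: comm_monoid_add"
  assumes "i < N"
  shows "(\<Sum>j<N. f j) = f i + (\<Sum>j\<in>{..<N}-{i}. f j)"
  using assms by (subst sum.remove[of _ i]) auto

definition smear :: "nat \<Rightarrow> (nat \<Rightarrow> real) \<Rightarrow> real \<Rightarrow> real measure" where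
  "smear N l h = density lborel (\<lambda>a. \<Sum>i<N. ennreal (1 / (real N * h)) * indicator {l i..l i + h} a)"

lemma sets_smear [measurable_cong, simp]: "sets (smear N l h) = sets borel"
  by (simp add: smear_def)

lemma nn_integral_smear:
  assumes [measurable]: "f \<in> borel_measurable borel"
  shows "(\<integral>\<^sup>+a. f a \<partial>smear N l h)
    = (\<Sum>i<N. ennreal (1 / (real N * h)) * (\<integral>\<^sup>+a. f a * indicator {l i..l i + h} a \<partial>lborel))"
proof -
  have "(\<integral>\<^sup>+a. f a \<partial>smear N l h)
    = (\<integral>\<^sup>+a. (\<Sum>i<N. ennreal (1 / (real N * h)) * (f a * indicator {l i..l i + h} a)) \<partial>lborel)"
    unfolding smear_def
    by (subst nn_integral_density, measurable, intro nn_integral_cong)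
       (simp only: sum_distrib_left mult.assoc mult.commute mult.left_commute)
  also have "\<dots> = (\<Sum>i<N. ennreal (1 / (real N * h)) * (\<integral>\<^sup>+a. f a * indicator {l i..l i + h} a \<partial>lborel))"
    by (subst nn_integral_sum) (auto simp: nn_integral_cmult)
  finally show ?thesis .
qed

lemma smear_in_borel_prob_measures:
  assumes "N \<ge> 1" "h > 0"
  shows "smear N l h \<in> borel_prob_measures"
proof -
  have "emeasure (smear N l h) (space (smear N l h)) = (\<integral>\<^sup>+a. 1 \<partial>smear N l h)" by simp
  also have "\<dots> = (\<Sum>i<N. ennreal (1 / (real N * h)) * ennreal h)"
    using assms by (subst nn_integral_smear) (auto simp: ac_simps)
  also have "\<dots> = 1"
    using assms by (simp add: ennreal_mult[symmetric] ennreal_of_nat_eq_real_of_nat)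
  finally show ?thesis by (auto simp: borel_prob_measures_def intro!: prob_spaceI)
qed

lemma nn_integral_indicator_le:
  assumes "\<And>a. a \<in> {l..l+h} \<Longrightarrow> f a \<le> c" "h \<ge> 0"
  shows "(\<integral>\<^sup>+a. f a * indicator {l..l + h} a \<partial>lborel) \<le> c * ennreal h"
proof -
  have "(\<integral>\<^sup>+a. f a * indicator {l..l + h} a \<partial>lborel) \<le> (\<integral>\<^sup>+a. c * indicator {l..l + h} a \<partial>lborel)"
    using assms by (intro nn_integral_mono) (auto simp: indicator_def)
  also have "\<dots> = c * ennreal h" using assms by (simp add: nn_integral_cmult)
  finally show ?thesis .
qed

context log_gas
begin

definition E :: ereal where
  "E = (INF \<mu>\<in>borel_prob_measures. I \<mu>)"

text \<open>Starting at \<open>x i + h\<close> rather than at \<open>x i\<close> keeps the intervals off the singularity of \<open>ls\<close> at \<open>0\<close>.\<close>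

lemma I_smear_le:
  assumes "config N x" "N \<ge> 2"
  defines "h \<equiv> 1 / real N ^ 3"
  defines "l \<equiv> \<lambda>i. x i + h * real (i + 1)"
  shows "(real N)\<^sup>2 * (real_of_ereal (I (smear N l h)) + B)
      \<le> K N x + (real N)\<^sup>2 * B + 5 * q * (\<Sum>i<N. (x i)\<^sup>2) + real N * (12 * q + (\<kappa> + 2 * \<beta>) * (1 - ln h))"
    and "\<bar>I (smear N l h)\<bar> \<noteq> \<infinity>"
proof -
  have N: "real N \<ge> 2" using assms by simp
  have h: "0 < h" "h \<le> 1" using N by (auto simp: h_def)
  \<comment> \<open>h (N + 1) is the displacement of the right end of the last interval; hence every
    point moves by O(1 / N), as \<open>sq_shift_le\<close> requires.\<close>
  have hN: "h * (real N + 1) \<le> 2 / real N"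
  proof -
    have "h * (real N + 1) \<le> h * (2 * (real N * real N))" using h N
      by (intro mult_left_mono) (auto intro: order_trans[of _ "2 * real N"])
    also have "\<dots> = 2 / real N" using N by (simp add: h_def power3_eq_cube)
    finally show ?thesis .
  qed
  define C where "C i = {l i..l i + h}" for i
  have shift: "\<bar>a - x i\<bar> \<le> 2 / real N" "x i \<le> a" "x i + h \<le> a" if "a \<in> C i" "i < N" for a i
  proof -
    have "0 \<le> h * real i" "h * (real i + 2) \<le> h * (real N + 1)"
      using h that by (auto intro!: mult_left_mono)
    moreover have "x i + h * real i + h \<le> a" "a \<le> x i + h * (real i + 2)"
      using that by (auto simp: C_def l_def algebra_simps)
    ultimately show "\<bar>a - x i\<bar> \<le> 2 / real N" "x i \<le> a" "x i + h \<le> a"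
      using hN h by linarith+
  qed
  have lnh: "- ln h \<ge> 0" using h by simp
  then have w0: "0 \<le> 2 * \<beta> * (1 - ln h)" using beta_pos by (intro mult_nonneg_nonneg) auto
  then have w1: "0 \<le> 2 * \<beta> * (1 - ln h) * h" by (rule mult_nonneg_nonneg[OF _ less_imp_le[OF h(1)]])
  let ?s = "\<lambda>z::real. (2 * z\<^sup>2 + 6) / real N"
  \<comment> \<open>\<open>c i j\<close> will bound the shifted kernel on a product of two different
    intervals; \<open>d i\<close> will bound its part without the logarithm of the distance on the
    square of one interval.\<close>
  define c where "c i j = k (x i) (x j) + B + q / 2 * ?s (x i) + q / 2 * ?s (x j)" for i j
  define d where "d i = B + q * (3 * (x i)\<^sup>2 + 6) - \<kappa> * ln h" for i
  have c_nonneg: "c i j \<ge> 0" for i j using k_nonneg[of "x i" "x j"] q_pos by (simp add: c_def)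
  have d_nonneg: "d i \<ge> 0" for i
  proof -
    have "0 \<le> q * (3 * (x i)\<^sup>2 + 6)" using q_pos by simp
    then show ?thesis using B_nonneg mult_nonneg_nonneg[OF kappa_nonneg lnh] by (simp add: d_def)
  qed
  have x0: "s \<Longrightarrow> 0 \<le> x i" "\<kappa> \<noteq> 0 \<Longrightarrow> x i \<noteq> 0" if "i < N" for i
    using assms(1) that unfolding config_def by auto
  have lt_case: "a < b \<and> k a b + B \<le> c i j"
    if "i < j" "j < N" "a \<in> C i" "b \<in> C j" for i j a b
  proof -
    have xij: "x i < x j" using assms(1) that unfolding config_def by auto
    \<comment> \<open>Interval i ends at displacement h (i + 2), interval j starts at h (j + 1), and
      i + 1 is at most j; so the gap does not shrink.\<close>
    have "h * (real i + 2) \<le> h * (real j + 1)" using h that by (intro mult_left_mono) auto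
    then have gap: "x j - x i \<le> b - a" using that by (auto simp: C_def l_def algebra_simps)
    have "k a b \<le> k (x i) (x j) + q / 2 * (a\<^sup>2 - (x i)\<^sup>2) + q / 2 * (b\<^sup>2 - (x j)\<^sup>2)"
      using gap xij that shift(2)[of a i] shift(2)[of b j] x0[of i] by (intro k_mono) auto
    moreover have "q / 2 * (u\<^sup>2 - (x m)\<^sup>2) \<le> q / 2 * ?s (x m)" if "u \<in> C m" "m < N" for u m
    proof -
      have "u\<^sup>2 - (x m)\<^sup>2 \<le> ?s (x m)" using sq_shift_le[of N u "x m"] shift(1)[OF that] N by simp
      then show ?thesis using q_pos by (intro mult_left_mono) auto
    qed
    from this[of a i] this[of b j] have "q / 2 * (a\<^sup>2 - (x i)\<^sup>2) \<le> q / 2 * ?s (x i)" "q / 2 * (b\<^sup>2 - (x j)\<^sup>2) \<le> q / 2 * ?s (x j)"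
      using that by simp_all
    ultimately show ?thesis using gap xij unfolding c_def by (intro conjI; linarith)
  qed
  have off: "k_hat a b \<le> ennreal (c i j)"
    if "i < N" "j < N" "i \<noteq> j" "a \<in> C i" "b \<in> C j" for i j a b
  proof -
    have "a \<noteq> b \<and> k a b + B \<le> c i j"
    proof (cases "i < j")
      case True
      then show ?thesis using lt_case[of i j a b] that by auto
    next
      case False
      then show ?thesis
        using lt_case[of j i b a] that k_commute[of a b] k_commute[of "x i" "x j"] by (auto simp: c_def)
    qed
    moreover have "s \<Longrightarrow> 0 < a \<and> 0 < b"
      using shift(3)[of a i] shift(3)[of b j] x0[of i] x0[of j] that h by force
    then have "nonsing a b" using \<open>a \<noteq> b \<and> _\<close> kappa_zero unfolding nonsing_def by force
    ultimately show ?thesis by (auto simp: k_hat_def intro!: ennreal_leI)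
  qed
  have diag: "k_hat a b \<le> ennreal (d i) + ennreal \<beta> * (ennreal (- ln \<bar>a - b\<bar>))"
    if "i < N" "a \<in> C i" "b \<in> C i" "a \<noteq> b" for i a b
  proof -
    have ab: "\<bar>a - b\<bar> \<le> h" using that by (auto simp: C_def)
    have pos: "s \<Longrightarrow> h \<le> a \<and> h \<le> b" using shift(3)[of a i] shift(3)[of b i] x0[of i] that by force
    have "k a b \<le> q / 2 * (a\<^sup>2 + b\<^sup>2) - \<kappa> * ln h + \<beta> * (- ln \<bar>a - b\<bar>)"
      using pos h ab that by (intro k_diagonal_le) auto
    moreover have "q / 2 * (a\<^sup>2 + b\<^sup>2) \<le> q / 2 * ((3 * (x i)\<^sup>2 + 6) + (3 * (x i)\<^sup>2 + 6))"
      using sq_shift_le'[of N a "x i"] sq_shift_le'[of N b "x i"] shift(1)[of a i] shift(1)[of b i] that N q_pos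
      by (intro mult_left_mono add_mono) auto
    ultimately have "k a b + B \<le> d i + \<beta> * (- ln \<bar>a - b\<bar>)" by (simp add: d_def algebra_simps)
    moreover have "- ln \<bar>a - b\<bar> \<ge> 0" using ab h that by simp
    then have "ennreal (d i) + ennreal \<beta> * ennreal (- ln \<bar>a - b\<bar>) = ennreal (d i + \<beta> * (- ln \<bar>a - b\<bar>))"
      using d_nonneg[of i] beta_pos mult_nonneg_nonneg[of \<beta> "- ln \<bar>a - b\<bar>"]
      by (subst ennreal_plus) (auto simp only: ennreal_mult)
    moreover have "nonsing a b" using pos h that kappa_zero unfolding nonsing_def by force
    ultimately show ?thesis unfolding k_hat_def by (auto intro!: ennreal_leI)
  qed
  let ?\<mu> = "smear N l h"
  have \<mu>: "?\<mu> \<in> borel_prob_measures" using N h by (intro smear_in_borel_prob_measures) auto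
  let ?n = "1 / (real N * h)"
  \<comment> \<open>Every interval has mass 1 / N. On its own interval the logarithm contributes
    \<beta> / h times the bound 2 (h - h ln h) of \<open>nn_integral_neg_ln_dist_le\<close>.\<close>
  define G where "G i = ((\<Sum>j\<in>{..<N}-{i}. c i j) + d i + 2 * \<beta> * (1 - ln h)) / real N" for i
  have G_nonneg: "0 \<le> G i" for i
    unfolding G_def
      using c_nonneg d_nonneg[of i] w0 by (intro divide_nonneg_nonneg add_nonneg_nonneg sum_nonneg) auto
  have k_hat_measurable [measurable]: "k_hat a \<in> borel_measurable borel" for a
  proof -
    have "(\<lambda>b. k_hat (fst (a, b)) (snd (a, b))) \<in> borel_measurable borel" by measurable
    then show ?thesis by simp
  qed
  have inner: "(\<integral>\<^sup>+b. k_hat a b \<partial>?\<mu>) \<le> ennreal (G i)" if i: "i < N" and a: "a \<in> C i" for i a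
  proof -
    have 1: "(\<integral>\<^sup>+b. k_hat a b * indicator {l j..l j + h} b \<partial>lborel) \<le> ennreal (c i j * h)" if "j \<in> {..<N}-{i}" for j
      using nn_integral_indicator_le[of "l j" h "k_hat a" "ennreal (c i j)"] off[of i j a] h that i a c_nonneg[of i j]
      by (simp add: ennreal_mult C_def)
    have "(\<integral>\<^sup>+b. k_hat a b * indicator {l i..l i + h} b \<partial>lborel)
       \<le> (\<integral>\<^sup>+b. ennreal (d i) * indicator {l i..l i + h} b
            + ennreal \<beta> * (ennreal (- ln \<bar>a - b\<bar>) * indicator {a - h<..<a + h} b) \<partial>lborel)"
    proof (intro nn_integral_mono_AE)
      \<comment> \<open>The point \<open>a\<close> is removed because \<open>k_hat\<close> is
        infinite on the diagonal, and the points at distance \<open>h\<close> because the comparison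
        interval is open.\<close>
      have "AE b in lborel. b \<notin> {a, a - h, a + h}"
        by (intro AE_not_in finite_imp_null_set_lborel) auto
      then show "AE b in lborel. k_hat a b * indicator {l i..l i + h} b \<le> ennreal (d i) * indicator {l i..l i + h} b
            + ennreal \<beta> * (ennreal (- ln \<bar>a - b\<bar>) * indicator {a - h<..<a + h} b)"
      proof (rule AE_mp, intro AE_I2 impI)
        fix b assume b: "b \<notin> {a, a - h, a + h}"
        show "k_hat a b * indicator {l i..l i + h} b \<le> ennreal (d i) * indicator {l i..l i + h} b
            + ennreal \<beta> * (ennreal (- ln \<bar>a - b\<bar>) * indicator {a - h<..<a + h} b)"
        proof (cases "b \<in> {l i..l i + h}")
          case True
          then have "b \<in> {a - h<..<a + h}" using a b by (auto simp: C_def)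
          then show ?thesis using diag[of i a b] i a b True by (simp add: C_def)
        qed simp
      qed
    qed
    also have "\<dots> = (\<integral>\<^sup>+b. ennreal (d i) * indicator {l i..l i + h} b \<partial>lborel)
        + (\<integral>\<^sup>+b. ennreal \<beta> * (ennreal (- ln \<bar>a - b\<bar>) * indicator {a - h<..<a + h} b) \<partial>lborel)"
      by (intro nn_integral_add) auto
    also have "(\<integral>\<^sup>+b. ennreal (d i) * indicator {l i..l i + h} b \<partial>lborel) = ennreal (d i * h)"
      using h d_nonneg[of i] by (simp add: nn_integral_cmult ennreal_mult)
    also have "(\<integral>\<^sup>+b. ennreal \<beta> * (ennreal (- ln \<bar>a - b\<bar>) * indicator {a - h<..<a + h} b) \<partial>lborel)
       = ennreal \<beta> * (\<integral>\<^sup>+b. ennreal (- ln \<bar>a - b\<bar>) * indicator {a - h<..<a + h} b \<partial>lborel)"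
      by (intro nn_integral_cmult) auto
    also have "\<dots> \<le> ennreal \<beta> * ennreal (2 * (h - h * ln h))"
      using h by (intro mult_left_mono nn_integral_neg_ln_dist_le) auto
    also have "\<dots> = ennreal (2 * \<beta> * (1 - ln h) * h)"
    proof -
      have "0 \<le> h * (1 - ln h)" using lnh h by (intro mult_nonneg_nonneg) linarith+
      then show ?thesis using beta_pos by (subst ennreal_mult[symmetric]) (auto simp: algebra_simps)
    qed
    finally have 2: "(\<integral>\<^sup>+b. k_hat a b * indicator {l i..l i + h} b \<partial>lborel)
      \<le> ennreal (d i * h + 2 * \<beta> * (1 - ln h) * h)"
      using ennreal_plus[OF mult_nonneg_nonneg[OF d_nonneg[of i] less_imp_le[OF h(1)]] w1] by simp
    have "(\<integral>\<^sup>+b. k_hat a b \<partial>?\<mu>)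
      = ennreal ?n * (\<Sum>j<N. (\<integral>\<^sup>+b. k_hat a b * indicator {l j..l j + h} b \<partial>lborel))"
      by (subst nn_integral_smear) (auto simp: sum_distrib_left)
    also have "\<dots> \<le> ennreal ?n * (ennreal (d i * h + 2 * \<beta> * (1 - ln h) * h) + (\<Sum>j\<in>{..<N}-{i}. ennreal (c i j * h)))"
      unfolding sum_pairs_split[OF i] using 1 2 by (intro mult_left_mono add_mono sum_mono) auto
    also have "(\<Sum>j\<in>{..<N}-{i}. ennreal (c i j * h)) = ennreal (\<Sum>j\<in>{..<N}-{i}. c i j * h)"
      using c_nonneg h by (intro sum_ennreal) auto
    also have "ennreal ?n * (ennreal (d i * h + 2 * \<beta> * (1 - ln h) * h) + ennreal (\<Sum>j\<in>{..<N}-{i}. c i j * h))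
      = ennreal (?n * ((d i * h + 2 * \<beta> * (1 - ln h) * h) + (\<Sum>j\<in>{..<N}-{i}. c i j * h)))"
    proof -
      have "0 \<le> d i * h + 2 * \<beta> * (1 - ln h) * h"
        using add_nonneg_nonneg[OF mult_nonneg_nonneg[OF d_nonneg[of i] less_imp_le[OF h(1)]] w1] .
      moreover have "0 \<le> (\<Sum>j\<in>{..<N}-{i}. c i j * h)" "0 \<le> ?n"
        using c_nonneg h by (auto intro!: sum_nonneg)
      ultimately show ?thesis
        by (simp only: ennreal_plus[symmetric] ennreal_mult[symmetric] add_nonneg_nonneg)
    qed
    also have "?n * ((d i * h + 2 * \<beta> * (1 - ln h) * h) + (\<Sum>j\<in>{..<N}-{i}. c i j * h)) = G i"
      using h N unfolding G_def sum_distrib_right[symmetric] by (simp add: field_simps)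
    finally show ?thesis .
  qed
  let ?J = "\<integral>\<^sup>+a. \<integral>\<^sup>+b. k_hat a b \<partial>?\<mu> \<partial>?\<mu>"
  interpret prob_space ?\<mu> using \<mu> by (simp add: borel_prob_measures_def)
  have [measurable]: "(\<lambda>a. \<integral>\<^sup>+b. k_hat a b \<partial>?\<mu>) \<in> borel_measurable borel"
    using borel_measurable_nn_integral_fst[of "\<lambda>z. k_hat (fst z) (snd z)" borel]
    by (simp cong: measurable_cong_sets)
  have "?J = ennreal ?n * (\<Sum>i<N. (\<integral>\<^sup>+a. (\<integral>\<^sup>+b. k_hat a b \<partial>?\<mu>) * indicator {l i..l i + h} a \<partial>lborel))"
    by (subst nn_integral_smear) (auto simp: sum_distrib_left)
  also have "\<dots> \<le> ennreal ?n * (\<Sum>i<N. ennreal (G i) * ennreal h)"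
    using inner h by (intro mult_left_mono sum_mono nn_integral_indicator_le) (auto simp: C_def)
  also have "\<dots> = ennreal (?n * (\<Sum>i<N. G i * h))"
    using G_nonneg h by (simp add: ennreal_mult[symmetric] sum_nonneg)
  also have "?n * (\<Sum>i<N. G i * h) = (\<Sum>i<N. G i) / real N"
    using h N unfolding sum_distrib_right[symmetric] by (simp add: field_simps)
  finally have J: "?J \<le> ennreal ((\<Sum>i<N. G i) / real N)" .
  have GN: "0 \<le> (\<Sum>i<N. G i) / real N" using G_nonneg by (simp add: sum_nonneg)
  obtain r where r: "?J = ennreal r" "0 \<le> r"
    using J by (cases ?J) (auto simp: top_unique)
  have Ir: "I ?\<mu> = ereal (r - B)" unfolding I_eq[OF \<mu>] r using r by (simp add: enn2ereal_ennreal)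
  then show "\<bar>I ?\<mu>\<bar> \<noteq> \<infinity>" by simp
  have "r \<le> (\<Sum>i<N. G i) / real N" using J GN unfolding r by (simp add: ennreal_le_iff)
  then have "(real N)\<^sup>2 * r \<le> (real N)\<^sup>2 * ((\<Sum>i<N. G i) / real N)" by (intro mult_left_mono) auto
  also have "\<dots> = (\<Sum>i<N. real N * G i)"
    using N by (simp add: power2_eq_square sum_distrib_left[symmetric])
  also have "\<dots> = (\<Sum>i<N. \<Sum>j\<in>{..<N}-{i}. c i j) + (\<Sum>i<N. d i) + real N * (2 * \<beta> * (1 - ln h))"
    using N by (simp add: G_def sum.distrib)
  also have "(\<Sum>i<N. \<Sum>j\<in>{..<N}-{i}. c i j) = K N x + real N * real (N - 1) * B
      + real (N - 1) * (\<Sum>i<N. q / 2 * ?s (x i)) + real (N - 1) * (\<Sum>i<N. q / 2 * ?s (x i))"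
    unfolding c_def sum.distrib sum_pairs_const sum_pairs_fst sum_pairs_snd K_def ..
  also have "(\<Sum>i<N. q / 2 * ?s (x i)) = (q * (\<Sum>i<N. (x i)\<^sup>2) + 3 * q * real N) / real N"
    by (simp add: sum_distrib_left sum.distrib add_divide_distrib sum_divide_distrib algebra_simps)
  also have "(\<Sum>i<N. d i) = real N * B + 3 * q * (\<Sum>i<N. (x i)\<^sup>2) + 6 * q * real N - real N * (\<kappa> * ln h)"
    by (simp add: d_def sum.distrib sum_distrib_left sum_subtractf algebra_simps)
  finally have fin: "(real N)\<^sup>2 * r \<le> K N x + real N * real (N - 1) * B
      + real (N - 1) * ((q * (\<Sum>i<N. (x i)\<^sup>2) + 3 * q * real N) / real N)
      + real (N - 1) * ((q * (\<Sum>i<N. (x i)\<^sup>2) + 3 * q * real N) / real N)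
      + (real N * B + 3 * q * (\<Sum>i<N. (x i)\<^sup>2) + 6 * q * real N - real N * (\<kappa> * ln h))
      + real N * (2 * \<beta> * (1 - ln h))" .
  \<comment> \<open>The off-diagonal shifts give two terms \<open>W\<close>, each at most q T + 3 q
    N, and the sum of the \<open>d i\<close> gives 3 q T + 6 q N; this explains 5 q and 12
    q.\<close>
  define T where "T = (\<Sum>i<N. (x i)\<^sup>2)"
  define W where "W = real (N - 1) * ((q * T + 3 * q * real N) / real N)"
  have W: "W \<le> q * T + 3 * q * real N"
  proof -
    have "0 \<le> q * T + 3 * q * real N" using q_pos by (simp add: T_def sum_nonneg)
    then have "real (N - 1) * (q * T + 3 * q * real N) \<le> real N * (q * T + 3 * q * real N)"
      by (intro mult_right_mono) auto
    then show ?thesis using N by (simp add: W_def field_simps)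
  qed
  have NB: "real N * real (N - 1) * B + real N * B = (real N)\<^sup>2 * B"
    using assms(2) by (cases N) (auto simp: power2_eq_square algebra_simps)
  have "real N * \<kappa> \<ge> 0" using kappa_nonneg by simp
  with fin[folded T_def, folded W_def] W NB have "(real N)\<^sup>2 * r \<le> K N x + (real N)\<^sup>2 * B + 5 * q * T
      + (12 * q * real N + real N * \<kappa> - real N * (\<kappa> * ln h) + real N * (2 * \<beta> * (1 - ln h)))"
    unfolding mult.assoc by argo
  also have "12 * q * real N + real N * \<kappa> - real N * (\<kappa> * ln h) + real N * (2 * \<beta> * (1 - ln h))
      = real N * (12 * q + (\<kappa> + 2 * \<beta>) * (1 - ln h))"
    by (simp add: algebra_simps)
  finally show "(real N)\<^sup>2 * (real_of_ereal (I ?\<mu>) + B)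
      \<le> K N x + (real N)\<^sup>2 * B + 5 * q * (\<Sum>i<N. (x i)\<^sup>2) + real N * (12 * q + (\<kappa> + 2 * \<beta>) * (1 - ln h))"
    by (simp add: Ir T_def)
qed

end

subsection \<open>Energies of large configurations\<close>

text \<open>The logarithm comes from the interval length N^(-3); the summand 1 lets the same scale
  absorb errors of order N.\<close>

definition err :: "nat \<Rightarrow> real" where
  "err N = real N * (1 + ln (real N))"

lemma err_ge: "N \<ge> 1 \<Longrightarrow> real N \<le> err N" "N \<ge> 1 \<Longrightarrow> real N * ln (real N) \<le> err N"
  by (simp_all add: err_def algebra_simps)

context log_gas
begin

lemma I_ge: "\<mu> \<in> borel_prob_measures \<Longrightarrow> ereal (- B) \<le> I \<mu>"
  using enn2ereal_nonneg[of "\<integral>\<^sup>+x. \<integral>\<^sup>+y. k_hat x y \<partial>\<mu> \<partial>\<mu>"]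
  by (cases "enn2ereal (\<integral>\<^sup>+x. \<integral>\<^sup>+y. k_hat x y \<partial>\<mu> \<partial>\<mu>)") (auto simp: I_eq)

lemma E_ge: "ereal (- B) \<le> E"
  unfolding E_def by (intro INF_greatest I_ge)

text \<open>For the upper side one measure of finite energy is enough. The points 1 and 2 form a
  configuration for all values of \<open>s\<close> and \<kappa>, and smearing them gives such a
  measure.\<close>

lemma E_finite: "\<bar>E\<bar> \<noteq> \<infinity>"
proof -
  let ?x = "\<lambda>i::nat. real i + 1"
  let ?\<mu> = "smear 2 (\<lambda>i. ?x i + 1 / real 2 ^ 3 * real (i + 1)) (1 / real 2 ^ 3)"
  have "config 2 ?x" unfolding config_def by auto
  from I_smear_le(2)[OF this] have "\<bar>I ?\<mu>\<bar> \<noteq> \<infinity>" by simp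
  moreover have "E \<le> I ?\<mu>"
    unfolding E_def by (intro INF_lower smear_in_borel_prob_measures) auto
  ultimately show ?thesis using E_ge by (cases E; cases "I ?\<mu>") auto
qed

definition e :: real where
  "e = real_of_ereal E"

lemma E_eq: "E = ereal e"
  using E_finite by (simp add: e_def ereal_real)

lemma e_ge: "e + B \<ge> 0"
  using E_ge unfolding E_eq by simp

text \<open>Coercivity together with N - 1 \<ge> N / 2. It controls the second moment by the energy
  of the same configuration, for which nothing is assumed in advance.\<close>

lemma sum_sq_le:
  assumes "N \<ge> 2"
  shows "q * (\<Sum>i<N. (x i)\<^sup>2) \<le> 4 / real N * (K N x + (real N)\<^sup>2 * B)"
    and "0 \<le> K N x + (real N)\<^sup>2 * B"
proof -
  let ?T = "\<Sum>i<N. (x i)\<^sup>2" and ?P = "K N x + (real N)\<^sup>2 * B"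
  have N: "real (N - 1) = real N - 1" "real N \<ge> 2" using assms by auto
  have "(real N - 1) * (q / 2 * ?T) \<le> K N x + (real N - 1) * (real N * B)"
    using K_coercive[of N x] unfolding N by (simp add: algebra_simps)
  also have "\<dots> \<le> ?P" 
    using B_nonneg N mult_right_mono[of "real N - 1" "real N" "real N * B"]
      by (simp add: power2_eq_square algebra_simps)
  finally have 1: "(real N - 1) * (q / 2 * ?T) \<le> ?P" .
  have "0 \<le> q / 2 * ?T" using q_pos by (simp add: sum_nonneg)
  then have "real N / 2 * (q / 2 * ?T) \<le> (real N - 1) * (q / 2 * ?T)"
    using N by (intro mult_right_mono) auto
  with 1 have "real N / 2 * (q / 2 * ?T) \<le> ?P" by linarith
  then show "q * ?T \<le> 4 / real N * ?P" using N by (simp add: field_simps)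
  show "0 \<le> ?P"
    using \<open>0 \<le> q / 2 * ?T\<close> 1 N by (meson mult_nonneg_nonneg order_trans diff_ge_0_iff_ge one_le_numeral)
qed

lemma ln_h: "N \<ge> 1 \<Longrightarrow> ln (1 / real N ^ 3) = - (3 * ln (real N))"
  by (simp add: ln_div ln_realpow)

text \<open>By \<open>sum_sq_le\<close> the second moment in the smearing error costs only 20 / N of
  P = K + N^2 B. If P exceeds N^2 (e + B), the bound is immediate; otherwise that fraction is at
  most 20 (e + B) N.\<close>

lemma K_ge_config:
  assumes "config N x" "N \<ge> 2"
  shows "K N x \<ge> (real N)\<^sup>2 * e - (20 * (e + B) + 12 * q + 3 * (\<kappa> + 2 * \<beta>)) * err N"
proof -
  let ?h = "1 / real N ^ 3"
  let ?\<mu> = "smear N (\<lambda>i. x i + ?h * real (i + 1)) ?h"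
  let ?P = "K N x + (real N)\<^sup>2 * B"
  have N: "real N \<ge> 2" "N \<ge> 1" using assms by auto
  have lnN: "ln (real N) \<ge> 0" using N by simp
  have "E \<le> I ?\<mu>"
    unfolding E_def using N by (intro INF_lower smear_in_borel_prob_measures) auto
  then have "e \<le> real_of_ereal (I ?\<mu>)"
    using I_smear_le(2)[OF assms] unfolding E_eq by (cases "I ?\<mu>") auto
  then have "(real N)\<^sup>2 * (e + B) \<le> (real N)\<^sup>2 * (real_of_ereal (I ?\<mu>) + B)"
    by (intro mult_left_mono) auto
  also have "\<dots> \<le> ?P + 5 * q * (\<Sum>i<N. (x i)\<^sup>2) + real N * (12 * q + (\<kappa> + 2 * \<beta>) * (1 - ln ?h))"
    by (rule I_smear_le(1)[OF assms])
  also have "5 * q * (\<Sum>i<N. (x i)\<^sup>2) \<le> 20 / real N * ?P"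
  proof -
    have "5 * (q * (\<Sum>i<N. (x i)\<^sup>2)) \<le> 5 * (4 / real N * ?P)"
      using sum_sq_le(1)[OF assms(2), of x] by (intro mult_left_mono) auto
    then show ?thesis by (simp add: mult.assoc)
  qed
  also have "real N * (12 * q + (\<kappa> + 2 * \<beta>) * (1 - ln ?h)) \<le> (12 * q + 3 * (\<kappa> + 2 * \<beta>)) * err N"
  proof -
    have "12 * q * 1 \<le> 12 * q * (1 + ln (real N))" using q_pos lnN by (intro mult_left_mono) auto
    moreover have "(\<kappa> + 2 * \<beta>) * (1 - ln ?h) \<le> (\<kappa> + 2 * \<beta>) * (3 * (1 + ln (real N)))"
      using kappa_nonneg beta_pos N by (intro mult_left_mono) (auto simp: ln_h)
    ultimately have "12 * q + (\<kappa> + 2 * \<beta>) * (1 - ln ?h) \<le> (12 * q + 3 * (\<kappa> + 2 * \<beta>)) * (1 + ln (real N))"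
      by (simp add: algebra_simps)
    then have "real N * (12 * q + (\<kappa> + 2 * \<beta>) * (1 - ln ?h)) \<le> real N * ((12 * q + 3 * (\<kappa> + 2 * \<beta>)) * (1 + ln (real N)))"
      by (intro mult_left_mono) auto
    then show ?thesis by (simp add: err_def mult_ac)
  qed
  finally have main: "(real N)\<^sup>2 * (e + B) \<le> ?P + 20 / real N * ?P + (12 * q + 3 * (\<kappa> + 2 * \<beta>)) * err N"
    by simp
  have err: "real N \<le> err N" using err_ge N by auto
  show ?thesis
  proof (cases "?P \<le> (real N)\<^sup>2 * (e + B)")
    case True
    then have "20 / real N * ?P \<le> 20 / real N * ((real N)\<^sup>2 * (e + B))"
      by (intro mult_left_mono) auto
    also have "\<dots> = 20 * (e + B) * real N" using N by (simp add: power2_eq_square)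
    also have "\<dots> \<le> 20 * (e + B) * err N" using err e_ge by (intro mult_left_mono) auto
    finally show ?thesis using main by (simp add: algebra_simps)
  next
    case False
    have "0 \<le> (20 * (e + B) + 12 * q + 3 * (\<kappa> + 2 * \<beta>)) * err N"
      using e_ge q_pos kappa_nonneg beta_pos err N by (intro mult_nonneg_nonneg) auto
    then show ?thesis using False by (simp add: algebra_simps)
  qed
qed

lemma K_ge_good: "\<exists>C\<ge>0. \<forall>N\<ge>2. \<forall>x. good N x \<longrightarrow> K N x \<ge> (real N)\<^sup>2 * e - C * err N"
proof (intro exI conjI allI impI)
  show "0 \<le> 20 * (e + B) + 12 * q + 3 * (\<kappa> + 2 * \<beta>)"
    using e_ge q_pos kappa_nonneg beta_pos by (intro add_nonneg_nonneg) auto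
  fix N x assume "2 \<le> N" "good N x"
  then show "K N x \<ge> (real N)\<^sup>2 * e - (20 * (e + B) + 12 * q + 3 * (\<kappa> + 2 * \<beta>)) * err N"
    using K_ge_config by (metis good_imp_config)
qed

text \<open>As the infimum need not be attained, a measure within 1 / N of it is averaged; this
  slack and the difference between N (N - 1) and N^2 cost O(N). The factor 4 is that of
  \<open>sum_sq_le\<close>, which turns the energy bound into the moment bound.\<close>

lemma exists_near_minimiser:
  "\<exists>C\<ge>0. \<forall>N\<ge>2. \<exists>x. config N x \<and> K N x \<le> (real N)\<^sup>2 * e + C * real N \<and>
     q * (\<Sum>i<N. (x i)\<^sup>2) \<le> C * real N"
proof (rule exI[of _ "4 * (2 * \<bar>e\<bar> + 1 + B)"], intro conjI allI impI)
  let ?C = "4 * (2 * \<bar>e\<bar> + 1 + B)"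
  show "0 \<le> ?C" using B_nonneg by simp
  fix N :: nat assume N: "2 \<le> N"
  have "E < ereal (e + 1 / real N)" unfolding E_eq using N by simp
  then obtain \<mu> where "\<mu> \<in> borel_prob_measures" "I \<mu> < ereal (e + 1 / real N)"
    unfolding E_def by (auto simp: INF_less_iff)
  then obtain x where x: "config N x" "K N x \<le> real N * real (N - 1) * (e + 1 / real N)"
    using exists_config_le N by metis
  have "real N * real (N - 1) * (e + 1 / real N) = (real N)\<^sup>2 * e - real N * e + real N - 1"
    using N by (simp add: of_nat_diff power2_eq_square field_simps)
  moreover have "- (real N * e) \<le> real N * \<bar>e\<bar>"
    using mult_left_mono[of "- e" "\<bar>e\<bar>" "real N"] by simp
  ultimately have Kx: "K N x \<le> (real N)\<^sup>2 * e + (\<bar>e\<bar> + 1) * real N"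
    using x(2) by (simp add: algebra_simps)
  also have "\<dots> \<le> (real N)\<^sup>2 * e + ?C * real N"
    using B_nonneg by (intro add_left_mono mult_right_mono) auto
  finally have 1: "K N x \<le> (real N)\<^sup>2 * e + ?C * real N" .
  have "K N x + (real N)\<^sup>2 * B \<le> (real N)\<^sup>2 * (2 * \<bar>e\<bar> + 1 + B)"
  proof -
    have "(real N)\<^sup>2 * e \<le> (real N)\<^sup>2 * \<bar>e\<bar>" by (intro mult_left_mono) auto
    moreover have "(\<bar>e\<bar> + 1) * real N \<le> (\<bar>e\<bar> + 1) * (real N)\<^sup>2"
      using N by (intro mult_left_mono) (auto simp: power2_eq_square)
    ultimately show ?thesis using Kx by (simp add: algebra_simps)
  qed
  then have "4 / real N * (K N x + (real N)\<^sup>2 * B) \<le> 4 / real N * ((real N)\<^sup>2 * (2 * \<bar>e\<bar> + 1 + B))"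
    by (intro mult_left_mono) auto
  also have "\<dots> = ?C * real N" using N by (simp add: power2_eq_square)
  finally have "q * (\<Sum>i<N. (x i)\<^sup>2) \<le> ?C * real N" using sum_sq_le(1)[OF N, of x] by linarith
  with 1 x(1) show "\<exists>x. config N x \<and> K N x \<le> (real N)\<^sup>2 * e + ?C * real N \<and> q * (\<Sum>i<N. (x i)\<^sup>2) \<le> ?C * real N"
    by blast
qed

section \<open>The full exponent of the density\<close>

text \<open>\<open>p\<close> counts the copies of the potential beyond the N - 1 contained in
  \<open>K\<close>: 0 for type A, 1 otherwise. \<open>\<alpha>\<close> is what remains of the
  multiplicity of a_i after its part \<kappa> N has been put into the potential.\<close>

definition H :: "nat \<Rightarrow> real \<Rightarrow> real \<Rightarrow> real \<Rightarrow> (nat \<Rightarrow> real) \<Rightarrow> real" where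
  "H N p \<alpha> \<gamma> a = K N a + p * (\<Sum>i<N. V (a i)) - \<alpha> * (\<Sum>i<N. ls (a i)) - \<gamma> * (\<Sum>i<N. ls (2 * a i))"

text \<open>The one-body logarithms grow at most linearly, so a quadratic term of fixed strength
  beats them at a bounded cost per point, O(N) in total.\<close>

lemma H_ge:
  assumes "\<alpha> \<ge> 0" "\<gamma> \<ge> 0"
  shows "\<exists>C\<ge>0. \<forall>N\<ge>2. \<forall>p\<in>{0..1}. \<forall>a. good N a \<longrightarrow>
     H N p \<alpha> \<gamma> a \<ge> (real N)\<^sup>2 * e - C * err N + q / 8 * (\<Sum>i<N. (a i)\<^sup>2)"
proof -
  obtain C where C: "C \<ge> 0" "\<And>N x. N \<ge> 2 \<Longrightarrow> good N x \<Longrightarrow> K N x \<ge> (real N)\<^sup>2 * e - C * err N"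
    using K_ge_good by blast
  \<comment> \<open>Sum of the slopes: \<kappa> from \<open>p * V\<close>, \<alpha> from
    \<open>ls (a i)\<close>, and 2 \<gamma> from \<open>ls (2 * a i)\<close>.\<close>
  define M where "M = \<kappa> + \<alpha> + 2 * \<gamma>"
  define C' where "C' = \<bar>e\<bar> + C + B + 2 * M\<^sup>2 / q"
  have "C' \<ge> 0" using C(1) B_nonneg q_pos by (simp add: C'_def)
  moreover have "H N p \<alpha> \<gamma> a \<ge> (real N)\<^sup>2 * e - C' * err N + q / 8 * (\<Sum>i<N. (a i)\<^sup>2)"
    if N: "N \<ge> 2" and p: "p \<in> {0..1}" and a: "good N a" for N p a
  proof -
    let ?T = "\<Sum>i<N. (a i)\<^sup>2"
    have rN: "real N \<ge> 2" "real (N - 1) = real N - 1" using N by auto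
    have errN: "real N \<le> err N" using err_ge N by auto
    \<comment> \<open>The fraction \<open>1 / N\<close> of \<open>K\<close> is set aside to provide the Gaussian decay, also for \<open>p = 0\<close>.\<close>
    have "(1 - 1 / real N) * K N a \<ge> (1 - 1 / real N) * ((real N)\<^sup>2 * e - C * err N)"
      using C(2)[OF N a] rN by (intro mult_left_mono) auto
    moreover have "(1 - 1 / real N) * ((real N)\<^sup>2 * e - C * err N) = (real N)\<^sup>2 * e - real N * e - C * err N + C * err N / real N"
      using rN by (simp add: power2_eq_square field_simps)
    moreover have "C * err N / real N \<ge> 0"
      using C(1) errN rN by (intro divide_nonneg_nonneg mult_nonneg_nonneg) auto
    moreover have "real N * e \<le> \<bar>e\<bar> * err N"
    proof -
      have "real N * e \<le> real N * \<bar>e\<bar>" by (intro mult_left_mono) auto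
      also have "\<dots> \<le> err N * \<bar>e\<bar>" using errN by (intro mult_right_mono) auto
      finally show ?thesis by (simp add: mult.commute)
    qed
    ultimately have 1: "(1 - 1 / real N) * K N a \<ge> (real N)\<^sup>2 * e - \<bar>e\<bar> * err N - C * err N"
      by linarith
    have 2: "1 / real N * K N a \<ge> q / 4 * ?T - real N * B"
    proof -
      have "1 / real N * K N a \<ge> 1 / real N * ((real N - 1) * (q / 2 * ?T - real N * B))"
        using K_coercive[of N a] rN by (intro mult_left_mono) auto
      moreover have "1 / real N * ((real N - 1) * (q / 2 * ?T - real N * B)) = (1 - 1 / real N) * (q / 2 * ?T) - real N * B + B"
        using rN by (simp add: field_simps)
      moreover have "1 / 2 * (q / 2 * ?T) \<le> (1 - 1 / real N) * (q / 2 * ?T)"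
        using rN q_pos by (intro mult_right_mono) (auto simp: sum_nonneg field_simps)
      ultimately show ?thesis using B_nonneg by linarith
    qed
    have 3: "p * (\<Sum>i<N. V (a i)) \<ge> - (\<kappa> * (\<Sum>i<N. \<bar>a i\<bar>))"
    proof -
      have "p * V (a i) \<ge> - (\<kappa> * \<bar>a i\<bar>)" for i
      proof -
        have "0 \<le> q * (a i)\<^sup>2" using q_pos by simp
        then have "- (\<kappa> * \<bar>a i\<bar>) \<le> V (a i)" using V_ge[of "a i"] by linarith
        then have "p * - (\<kappa> * \<bar>a i\<bar>) \<le> p * V (a i)" using p by (intro mult_left_mono) auto
        moreover have "p * (\<kappa> * \<bar>a i\<bar>) \<le> 1 * (\<kappa> * \<bar>a i\<bar>)"
          using p kappa_nonneg by (intro mult_right_mono) auto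
        ultimately show ?thesis by simp
      qed
      then have "(\<Sum>i<N. - (\<kappa> * \<bar>a i\<bar>)) \<le> (\<Sum>i<N. p * V (a i))" by (intro sum_mono)
      then show ?thesis by (simp add: sum_distrib_left sum_negf)
    qed
    have 4: "\<alpha> * (\<Sum>i<N. ls (a i)) \<le> \<alpha> * (\<Sum>i<N. \<bar>a i\<bar>)"
      using assms by (intro mult_left_mono sum_mono ls_le_abs) auto
    have 5: "\<gamma> * (\<Sum>i<N. ls (2 * a i)) \<le> \<gamma> * (\<Sum>i<N. 2 * \<bar>a i\<bar>)"
      using assms ls_le_abs[of "2 * a i" for i]
        by (intro mult_left_mono sum_mono) (auto simp: abs_mult)
    have "(\<Sum>i<N. q / 4 * (a i)\<^sup>2 - M * \<bar>a i\<bar>) \<ge> (\<Sum>i<N. q / 8 * (a i)\<^sup>2 - 2 * M\<^sup>2 / q)"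
      using quadratic_ge[of "q / 4" _ M] q_pos by (intro sum_mono) (simp add: mult.commute)
    then have 6: "q / 4 * ?T - M * (\<Sum>i<N. \<bar>a i\<bar>) \<ge> q / 8 * ?T - real N * (2 * M\<^sup>2 / q)"
      by (simp only: sum_subtractf sum_distrib_left[symmetric]) simp
    have 7: "real N * (2 * M\<^sup>2 / q) \<le> err N * (2 * M\<^sup>2 / q)" "real N * B \<le> err N * B"
      using errN q_pos B_nonneg by (intro mult_right_mono; simp)+
    have "K N a = (1 - 1 / real N) * K N a + 1 / real N * K N a" by (simp add: algebra_simps)
    moreover have "M * (\<Sum>i<N. \<bar>a i\<bar>) = \<kappa> * (\<Sum>i<N. \<bar>a i\<bar>) + \<alpha> * (\<Sum>i<N. \<bar>a i\<bar>) + \<gamma> * (\<Sum>i<N. 2 * \<bar>a i\<bar>)"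
      unfolding M_def sum_distrib_left[symmetric] by (simp add: algebra_simps)
    moreover have "C' * err N = \<bar>e\<bar> * err N + C * err N + err N * B + err N * (2 * M\<^sup>2 / q)"
      by (simp add: C'_def algebra_simps)
    ultimately show ?thesis using 1 2 3 4 5 6 7 unfolding H_def by linarith
  qed
  ultimately show ?thesis by blast
qed

text \<open>What the boxes of both partition functions have in common. The last clause keeps the
  points at least N^(-3) away from 0, so one-body singularities cost O(log N) each; without
  \<open>s\<close> there are none, and points may also move left.\<close>

definition spread :: "nat \<Rightarrow> (nat \<Rightarrow> real) \<Rightarrow> (nat \<Rightarrow> real) \<Rightarrow> bool" where
  "spread N x a \<longleftrightarrow> (\<forall>i j. i < j \<longrightarrow> j < N \<longrightarrow> x j - x i \<le> a j - a i) \<and>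
     (\<forall>i<N. \<bar>a i - x i\<bar> \<le> 2 / real N) \<and> (s \<longrightarrow> (\<forall>i<N. x i + 1 / real N ^ 3 \<le> a i))"

text \<open>Moving the points of a configuration apart only decreases the interaction.\<close>

lemma H_le_of_spread:
  assumes x: "config N x" and N: "N \<ge> 2"
    and Kx: "K N x \<le> (real N)\<^sup>2 * e + C * real N" and Tx: "q * (\<Sum>i<N. (x i)\<^sup>2) \<le> C * real N"
    and spread: "spread N x a"
    and p: "p \<in> {0..1}" and \<alpha>: "\<alpha> \<ge> 0" "\<gamma> \<ge> 0" "s \<or> \<alpha> = 0 \<and> \<gamma> = 0"
  shows "good N a" and "H N p \<alpha> \<gamma> a \<le> (real N)\<^sup>2 * e + (6 * C + 12 * q + 3 * (\<kappa> + \<alpha> + \<gamma>)) * err N"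
proof -
  have gap: "x j - x i \<le> a j - a i" if "i < j" "j < N" for i j
    using spread that unfolding spread_def by blast
  have shift: "\<bar>a i - x i\<bar> \<le> 2 / real N" if "i < N" for i
    using spread that unfolding spread_def by blast
  have up: "x i + 1 / real N ^ 3 \<le> a i" if s "i < N" for i
    using spread that unfolding spread_def by blast
  let ?h = "1 / real N ^ 3" and ?s = "\<lambda>z::real. (2 * z\<^sup>2 + 6) / real N"
  define T where "T = (\<Sum>i<N. (x i)\<^sup>2)"
  have rN: "real N \<ge> 2" "N \<ge> 1" using N by auto
  have h: "0 < ?h" "?h \<le> 1" using rN by auto
  have errN: "real N \<le> err N" "real N * ln (real N) \<le> err N" using err_ge rN by auto
  have x0: "s \<Longrightarrow> 0 \<le> x i" "\<kappa> \<noteq> 0 \<Longrightarrow> x i \<noteq> 0" if "i < N" for i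
    using x that unfolding config_def by auto
  have a0: "?h \<le> a i" if "i < N" s for i using up[of i] x0(1)[of i] that by linarith
  have xlt: "x i < x j" if "i < j" "j < N" for i j using x that unfolding config_def by auto
  have alt: "a i < a j" if "i < j" "j < N" for i j using xlt[OF that] gap[OF that] by linarith
  show "good N a"
    unfolding good_def nonsing_def
  proof (intro allI impI)
    fix i j assume ij: "i < N" "j < N" "i \<noteq> j"
    have "0 < a i \<and> 0 < a j" if s
      using a0[OF ij(1) that] a0[OF ij(2) that] h(1) by (intro conjI; linarith)
    moreover have "a i \<noteq> a j" using alt[of i j] alt[of j i] ij by (cases "i < j") auto
    ultimately show "a i \<noteq> a j \<and> (s \<longrightarrow> a i + a j \<noteq> 0) \<and> (\<kappa> \<noteq> 0 \<longrightarrow> a i \<noteq> 0 \<and> a j \<noteq> 0)"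
      using kappa_zero by force
  qed
  have sq: "q / 2 * ((a i)\<^sup>2 - (x i)\<^sup>2) \<le> q / 2 * ?s (x i)" if "i < N" for i
  proof -
    have "(a i)\<^sup>2 - (x i)\<^sup>2 \<le> ?s (x i)"
      using sq_shift_le[of N "a i" "x i"] shift[OF that] rN by simp
    then show ?thesis using q_pos by (intro mult_left_mono) auto
  qed
  have lt_case: "k (a i) (a j) \<le> k (x i) (x j) + q / 2 * ?s (x i) + q / 2 * ?s (x j)" if "i < j" "j < N" for i j
  proof -
    have "0 \<le> x i \<and> x i \<le> a i \<and> x j \<le> a j" if s
      using \<open>i < j\<close> \<open>j < N\<close> x0(1)[of i] up[OF that, of i] up[OF that, of j] h(1) that
        by (intro conjI; linarith)
    then have "k (a i) (a j) \<le> k (x i) (x j) + q / 2 * ((a i)\<^sup>2 - (x i)\<^sup>2) + q / 2 * ((a j)\<^sup>2 - (x j)\<^sup>2)"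
      using that x0(2)[of i] by (intro k_mono xlt gap) auto
    then show ?thesis using sq[of i] sq[of j] that by linarith
  qed
  have kij: "k (a i) (a j) \<le> k (x i) (x j) + q / 2 * ?s (x i) + q / 2 * ?s (x j)" if "i < N" "j < N" "i \<noteq> j" for i j
  proof (cases "i < j")
    case True
    then show ?thesis using lt_case that by blast
  next
    case False
    then show ?thesis
      using lt_case[of j i] that k_commute[of "a i" "a j"] k_commute[of "x i" "x j"] by linarith
  qed
  define W where "W = real (N - 1) * ((q * T + 3 * q * real N) / real N)"
  have W: "W \<le> q * T + 3 * q * real N"
  proof -
    have "0 \<le> q * T + 3 * q * real N" using q_pos by (simp add: T_def sum_nonneg)
    then have "real (N - 1) * (q * T + 3 * q * real N) \<le> real N * (q * T + 3 * q * real N)"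
      by (intro mult_right_mono) auto
    then show ?thesis using rN by (simp add: W_def field_simps)
  qed
  have "K N a \<le> (\<Sum>i<N. \<Sum>j\<in>{..<N}-{i}. k (x i) (x j) + q / 2 * ?s (x i) + q / 2 * ?s (x j))"
    unfolding K_def using kij by (intro sum_mono) auto
  also have "\<dots> = K N x + real (N - 1) * (\<Sum>i<N. q / 2 * ?s (x i)) + real (N - 1) * (\<Sum>i<N. q / 2 * ?s (x i))"
    unfolding sum.distrib sum_pairs_fst sum_pairs_snd K_def ..
  also have "(\<Sum>i<N. q / 2 * ?s (x i)) = (q * T + 3 * q * real N) / real N"
    by (simp add: T_def sum_distrib_left sum.distrib add_divide_distrib sum_divide_distrib algebra_simps)
  finally have "K N a \<le> K N x + W + W" unfolding W_def .
  with W have 1: "K N a \<le> K N x + 2 * q * T + 6 * q * real N" unfolding mult.assoc by argo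
  have ln_h_nonpos: "ln ?h \<le> 0" using h by simp
  have lsa: "ln ?h \<le> ls (a i)" "ln ?h \<le> ls (2 * a i)" if "i < N" s for i
  proof -
    have "?h \<le> \<bar>a i\<bar>" "?h \<le> \<bar>2 * a i\<bar>" using a0[OF that] h(1) by linarith+
    then have "ln ?h \<le> ln \<bar>a i\<bar>" "ln ?h \<le> ln \<bar>2 * a i\<bar>"
      using ln_mono[OF _ h(1)] by blast+
    then show "ln ?h \<le> ls (a i)" "ln ?h \<le> ls (2 * a i)"
      using ln_le_ls[of "a i"] ln_le_ls[of "2 * a i"] by auto
  qed
  have 2: "p * (\<Sum>i<N. V (a i)) \<le> 3 * q * T + 6 * q * real N - real N * (\<kappa> * ln ?h)"
  proof -
    have "p * V (a i) \<le> q * (3 * (x i)\<^sup>2 + 6) - \<kappa> * ln ?h" if i: "i < N" for i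
    proof -
      have "\<kappa> * ln ?h \<le> \<kappa> * ls (a i)"
      proof (cases s)
        case True
        then show ?thesis using lsa(1)[OF i] kappa_nonneg by (intro mult_left_mono) auto
      next
        case False
        then show ?thesis using kappa_zero by simp
      qed
      moreover have "q * (a i)\<^sup>2 \<le> q * (3 * (x i)\<^sup>2 + 6)"
        using sq_shift_le'[of N "a i" "x i"] shift[OF i] rN q_pos by (intro mult_left_mono) auto
      ultimately have Vi: "V (a i) \<le> q * (3 * (x i)\<^sup>2 + 6) - \<kappa> * ln ?h" by (simp add: V_def)
      have "\<kappa> * ln ?h \<le> 0" "0 \<le> q * (3 * (x i)\<^sup>2 + 6)"
        using kappa_nonneg ln_h_nonpos q_pos by (auto intro: mult_nonneg_nonpos)
      then have "0 \<le> q * (3 * (x i)\<^sup>2 + 6) - \<kappa> * ln ?h"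
        unfolding diff_ge_0_iff_ge by (rule order_trans)
      then have "p * (q * (3 * (x i)\<^sup>2 + 6) - \<kappa> * ln ?h) \<le> q * (3 * (x i)\<^sup>2 + 6) - \<kappa> * ln ?h"
        using p by (intro mult_left_le_one_le) auto
      moreover have "p * V (a i) \<le> p * (q * (3 * (x i)\<^sup>2 + 6) - \<kappa> * ln ?h)"
        using Vi p by (intro mult_left_mono) auto
      ultimately show ?thesis by (rule order_trans[rotated])
    qed
    then have "(\<Sum>i<N. p * V (a i)) \<le> (\<Sum>i<N. q * (3 * (x i)\<^sup>2 + 6) - \<kappa> * ln ?h)"
      by (intro sum_mono) auto
    also have "\<dots> = 3 * q * T + 6 * q * real N - real N * (\<kappa> * ln ?h)"
      by (simp add: T_def sum.distrib sum_distrib_left sum_subtractf algebra_simps)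
    finally show ?thesis by (simp add: sum_distrib_left)
  qed
  have 3: "\<alpha> * (\<Sum>i<N. ls (a i)) \<ge> real N * (\<alpha> * ln ?h)" "\<gamma> * (\<Sum>i<N. ls (2 * a i)) \<ge> real N * (\<gamma> * ln ?h)"
  proof -
    have "(\<Sum>i<N. ln ?h) \<le> (\<Sum>i<N. ls (a i))" "(\<Sum>i<N. ln ?h) \<le> (\<Sum>i<N. ls (2 * a i))" if s
      using lsa that by (intro sum_mono; simp)+
    then have "\<alpha> * (real N * ln ?h) \<le> \<alpha> * (\<Sum>i<N. ls (a i))" "\<gamma> * (real N * ln ?h) \<le> \<gamma> * (\<Sum>i<N. ls (2 * a i))"
      using \<alpha> by (cases s; simp add: mult_left_mono)+
    then show "\<alpha> * (\<Sum>i<N. ls (a i)) \<ge> real N * (\<alpha> * ln ?h)" "\<gamma> * (\<Sum>i<N. ls (2 * a i)) \<ge> real N * (\<gamma> * ln ?h)"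
      by (simp_all add: mult_ac)
  qed
  have C: "C \<ge> 0"
  proof -
    have "0 \<le> q * T" using q_pos by (simp add: T_def sum_nonneg)
    then have "0 \<le> C * real N" using Tx by (simp add: T_def)
    then show ?thesis using rN by (simp add: zero_le_mult_iff)
  qed
  \<comment> \<open>q T enters twice through \<open>K\<close> and three times through the potential,
    and is at most C N; with the C N of \<open>Kx\<close> this makes 6 C. Each \<open>ln ?h\<close>
    equals - 3 ln N.\<close>
  have "H N p \<alpha> \<gamma> a \<le> (real N)\<^sup>2 * e + C * real N + 5 * (q * T) + 12 * q * real N
      - real N * (\<kappa> * ln ?h) - real N * (\<alpha> * ln ?h) - real N * (\<gamma> * ln ?h)"
    using 1 2 3 Kx unfolding H_def by linarith
  also have "\<dots> \<le> (real N)\<^sup>2 * e + (6 * C + 12 * q) * real N + 3 * (\<kappa> + \<alpha> + \<gamma>) * (real N * ln (real N))"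
    using Tx[folded T_def] rN by (simp add: ln_h algebra_simps)
  also have "\<dots> \<le> (real N)\<^sup>2 * e + (6 * C + 12 * q) * err N + 3 * (\<kappa> + \<alpha> + \<gamma>) * err N"
    using errN C q_pos kappa_nonneg \<alpha> by (intro add_mono order_refl mult_left_mono) auto
  finally show "H N p \<alpha> \<gamma> a \<le> (real N)\<^sup>2 * e + (6 * C + 12 * q + 3 * (\<kappa> + \<alpha> + \<gamma>)) * err N"
    by (simp add: algebra_simps)
qed

end

subsection \<open>Asymptotics of the partition functions\<close>

lemma nn_integral_gaussian:
  assumes "p > 0"
  shows "(\<integral>\<^sup>+x. ennreal (exp (- (p * x\<^sup>2))) \<partial>lborel) = ennreal (sqrt (pi / p))"
proof -
  let ?\<sigma> = "sqrt (1 / (2 * p))"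
  have "?\<sigma> > 0" using assms by simp
  then interpret prob_space "density lborel (\<lambda>x. ennreal (normal_density 0 ?\<sigma> x))"
    by (rule prob_space_normal_density)
  have "(\<integral>\<^sup>+x. ennreal (normal_density 0 ?\<sigma> x) \<partial>lborel) = 1"
    using emeasure_space_1 by (simp add: emeasure_density)
  moreover have "exp (- (p * x\<^sup>2)) = sqrt (pi / p) * normal_density 0 ?\<sigma> x" for x
    using assms by (simp add: normal_density_def real_sqrt_divide field_simps)
  ultimately show ?thesis
    using assms by (simp add: ennreal_mult nn_integral_cmult)
qed

text \<open>A Gaussian majorant factorises over the coordinates; from below, a box of volume
  \<open>h ^ r\<close> is enough. With h = N^(-3) and fixed \<open>p\<close> both corrections are
  O(N log N).\<close>

lemma ln_integral_bounds:
  fixes G :: "(nat \<Rightarrow> real) \<Rightarrow> real"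
  assumes [measurable]: "G \<in> borel_measurable (\<Pi>\<^sub>M i\<in>{..<r}. lborel)"
    and nonneg: "\<And>b. 0 \<le> G b" and h: "0 < h" and p: "0 < p"
    and upper: "\<And>b. G b \<le> exp U * (\<Prod>i<r. exp (- (p * (b i)\<^sup>2)))"
    and lower: "\<And>b. (\<And>i. i < r \<Longrightarrow> b i \<in> {l i..l i + h}) \<Longrightarrow> b \<in> extensional {..<r} \<Longrightarrow> exp D \<le> G b"
  defines "Z \<equiv> (\<integral>b. G b \<partial>(\<Pi>\<^sub>M i\<in>{..<r}. lborel))"
  shows "Z > 0" "D + real r * ln h \<le> ln Z" "ln Z \<le> U + real r * ln (sqrt (pi / p))"
proof -
  interpret product_sigma_finite "\<lambda>_::nat. lborel :: real measure" ..
  let ?M = "\<Pi>\<^sub>M i\<in>{..<r}. (lborel :: real measure)"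
  let ?N = "\<integral>\<^sup>+b. ennreal (G b) \<partial>?M"
  have "?N \<le> (\<integral>\<^sup>+b. ennreal (exp U) * (\<Prod>i<r. ennreal (exp (- (p * (b i)\<^sup>2)))) \<partial>?M)"
    using upper
      by (intro nn_integral_mono) (auto simp: prod_ennreal ennreal_mult[symmetric] prod_nonneg intro!: ennreal_leI)
  also have "\<dots> = ennreal (exp U) * (\<integral>\<^sup>+b. (\<Prod>i<r. ennreal (exp (- (p * (b i)\<^sup>2)))) \<partial>?M)"
    by (rule nn_integral_cmult) measurable
  also have "(\<integral>\<^sup>+b. (\<Prod>i<r. ennreal (exp (- (p * (b i)\<^sup>2)))) \<partial>?M) = (\<Prod>i<r. \<integral>\<^sup>+x. ennreal (exp (- (p * x\<^sup>2))) \<partial>lborel)"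
    by (rule product_nn_integral_prod) auto
  also have "\<dots> = ennreal (sqrt (pi / p) ^ r)"
    using p by (simp add: nn_integral_gaussian ennreal_power)
  also have "ennreal (exp U) * \<dots> = ennreal (exp U * sqrt (pi / p) ^ r)"
    using p by (simp add: ennreal_mult)
  finally have up: "?N \<le> ennreal (exp U * sqrt (pi / p) ^ r)" .
  let ?box = "\<Pi>\<^sub>E i\<in>{..<r}. {l i..l i + h}"
  have box: "?box \<in> sets ?M" by (intro sets_PiM_I_finite) auto
  have "ennreal (exp D * h ^ r) = ennreal (exp D) * emeasure ?M ?box"
    using h by (subst emeasure_PiM) (auto simp: ennreal_mult prod_ennreal ennreal_power)
  also have "\<dots> = (\<integral>\<^sup>+b. ennreal (exp D) * indicator ?box b \<partial>?M)"
    using box by (simp add: nn_integral_cmult_indicator)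
  also have "\<dots> \<le> ?N"
    using lower
      by (intro nn_integral_mono) (auto simp: indicator_def PiE_def Pi_def intro!: ennreal_leI)
  finally have lo: "ennreal (exp D * h ^ r) \<le> ?N" .
  have Z: "Z = enn2real ?N"
    unfolding Z_def using nonneg by (intro integral_eq_nn_integral) auto
  have fin: "?N < top" using up by (rule le_less_trans) simp
  have 1: "exp D * h ^ r \<le> Z"
    using enn2real_mono[OF lo fin] h unfolding Z by simp
  have 2: "Z \<le> exp U * sqrt (pi / p) ^ r"
    using enn2real_mono[OF up] p unfolding Z by simp
  have "0 < exp D * h ^ r" using h by simp
  with 1 show pos: "Z > 0" by linarith
  have "ln (exp D * h ^ r) \<le> ln Z" using 1 \<open>0 < exp D * h ^ r\<close> by (rule ln_mono)
  then show "D + real r * ln h \<le> ln Z" using h by (simp add: ln_mult ln_realpow)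
  have "ln Z \<le> ln (exp U * sqrt (pi / p) ^ r)" using 2 pos by (rule ln_mono)
  then show "ln Z \<le> U + real r * ln (sqrt (pi / p))" using p by (simp add: ln_mult ln_realpow)
qed

context log_gas
begin

lemma K_eq: "K N x = real (N - 1) * (\<Sum>i<N. V (x i)) - \<beta> * (\<Sum>j<N. \<Sum>i<j. L (x i) (x j))"
proof -
  have "K N x = (\<Sum>i<N. \<Sum>j\<in>{..<N}-{i}. V (x i) / 2 + V (x j) / 2 + (- (\<beta> / 2)) * L (x i) (x j))"
    by (simp add: K_def k_def)
  also have "\<dots> = real (N - 1) * (\<Sum>i<N. V (x i) / 2) + real (N - 1) * (\<Sum>i<N. V (x i) / 2)
      + (- (\<beta> / 2)) * (\<Sum>i<N. \<Sum>j\<in>{..<N}-{i}. L (x i) (x j))"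
    unfolding sum.distrib sum_pairs_fst sum_pairs_snd sum_distrib_left[symmetric] ..
  also have "(\<Sum>i<N. \<Sum>j\<in>{..<N}-{i}. L (x i) (x j)) = 2 * (\<Sum>j<N. \<Sum>i<j. L (x i) (x j))"
    using ls_minus_commute by (intro sum_pairs_eq_sum_lower) (simp add: L_def add.commute)
  finally show ?thesis by (simp add: sum_divide_distrib[symmetric] algebra_simps)
qed

text \<open>As \<open>ls 0 = 0\<close>, \<open>exp (- H)\<close> would be positive on the walls
  where the density vanishes, so the zeros are put in explicitly. The clause on \<alpha> + \<gamma>
  covers zeros of one-point factors that \<open>good\<close> does not see when \<kappa> = 0.\<close>

definition weight :: "nat \<Rightarrow> real \<Rightarrow> real \<Rightarrow> real \<Rightarrow> (nat \<Rightarrow> real) \<Rightarrow> real" where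
  "weight N p \<alpha> \<gamma> a =
     (if good N a \<and> (\<alpha> + \<gamma> > 0 \<longrightarrow> (\<forall>i<N. a i \<noteq> 0)) then exp (- H N p \<alpha> \<gamma> a) else 0)"

lemma weight_le:
  assumes "\<alpha> \<ge> 0" "\<gamma> \<ge> 0"
  shows "\<exists>C\<ge>0. \<forall>N\<ge>2. \<forall>p\<in>{0..1}. \<forall>a.
     weight N p \<alpha> \<gamma> a \<le> exp (- (real N)\<^sup>2 * e + C * err N) * (\<Prod>i<N. exp (- (q / 8 * (a i)\<^sup>2)))"
proof -
  obtain C where "C \<ge> 0" and C: "\<And>N p a. N \<ge> 2 \<Longrightarrow> p \<in> {0..1} \<Longrightarrow> good N a \<Longrightarrow>
     H N p \<alpha> \<gamma> a \<ge> (real N)\<^sup>2 * e - C * err N + q / 8 * (\<Sum>i<N. (a i)\<^sup>2)"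
    using H_ge[OF assms] by blast
  have "weight N p \<alpha> \<gamma> a \<le> exp (- (real N)\<^sup>2 * e + C * err N) * (\<Prod>i<N. exp (- (q / 8 * (a i)\<^sup>2)))"
    if "N \<ge> 2" "p \<in> {0..1}" for N p a
  proof (cases "good N a")
    case True
    have "exp (- H N p \<alpha> \<gamma> a) \<le> exp (- (real N)\<^sup>2 * e + C * err N + (\<Sum>i<N. - (q / 8 * (a i)\<^sup>2)))"
      using C[OF that True] by (simp add: sum_distrib_left sum_negf)
    also have "\<dots> = exp (- (real N)\<^sup>2 * e + C * err N) * (\<Prod>i<N. exp (- (q / 8 * (a i)\<^sup>2)))"
      by (simp only: exp_add exp_sum[OF finite_lessThan])
    finally show ?thesis by (simp add: weight_def prod_nonneg)
  qed (simp add: weight_def prod_nonneg)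
  with \<open>C \<ge> 0\<close> show ?thesis by blast
qed

lemma weight_eq_exp:
  assumes "good N a" "\<And>i. s \<Longrightarrow> i < N \<Longrightarrow> 0 < a i" "\<not> s \<Longrightarrow> \<alpha> = 0 \<and> \<gamma> = 0"
  shows "weight N p \<alpha> \<gamma> a = exp (- H N p \<alpha> \<gamma> a)"
proof -
  have "\<alpha> + \<gamma> > 0 \<longrightarrow> (\<forall>i<N. a i \<noteq> 0)" using assms(2,3) by (cases s) (metis less_irrefl, simp)
  then show ?thesis using assms(1) unfolding weight_def by metis
qed

lemma weight_nonneg: "0 \<le> weight N p \<alpha> \<gamma> a"
  by (simp add: weight_def)

lemma ln_partition_full_space:
  assumes s: s and \<alpha>: "\<alpha> \<ge> 0" "\<gamma> \<ge> 0"
  shows "\<exists>C. \<forall>N\<ge>2. weight N 1 \<alpha> \<gamma> \<in> borel_measurable (\<Pi>\<^sub>M i\<in>{..<N}. lborel) \<longrightarrow>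
     \<bar>ln (\<integral>a. weight N 1 \<alpha> \<gamma> a \<partial>(\<Pi>\<^sub>M i\<in>{..<N}. lborel)) + (real N)\<^sup>2 * e\<bar> \<le> C * err N"
proof -
  obtain C1 where C1: "C1 \<ge> 0" "\<And>N a. N \<ge> 2 \<Longrightarrow>
     weight N 1 \<alpha> \<gamma> a \<le> exp (- (real N)\<^sup>2 * e + C1 * err N) * (\<Prod>i<N. exp (- (q / 8 * (a i)\<^sup>2)))"
    using weight_le[OF \<alpha>] by (metis atLeastAtMost_iff order_refl zero_le_one)
  obtain C2 where C2: "C2 \<ge> 0" "\<And>N. N \<ge> 2 \<Longrightarrow> \<exists>x. config N x \<and> K N x \<le> (real N)\<^sup>2 * e + C2 * real N \<and>
     q * (\<Sum>i<N. (x i)\<^sup>2) \<le> C2 * real N"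
    using exists_near_minimiser by blast
  define C3 where "C3 = 6 * C2 + 12 * q + 3 * (\<kappa> + \<alpha> + \<gamma>)"
  define g where "g = sqrt (pi / (q / 8))"
  have C3: "C3 \<ge> 0" using C2 q_pos kappa_nonneg \<alpha> by (simp add: C3_def)
  \<comment> \<open>\<open>C1\<close> comes from the majorant, \<open>C3\<close> from the exponent
    on the box, 3 from the volume of the box, and \<open>g\<close> from the Gaussian
    integrals.\<close>
  have "\<bar>ln (\<integral>a. weight N 1 \<alpha> \<gamma> a \<partial>(\<Pi>\<^sub>M i\<in>{..<N}. lborel)) + (real N)\<^sup>2 * e\<bar> \<le> (C1 + C3 + 3 + \<bar>ln g\<bar>) * err N"
    if N: "N \<ge> 2" and [measurable]: "weight N 1 \<alpha> \<gamma> \<in> borel_measurable (\<Pi>\<^sub>M i\<in>{..<N}. lborel)" for N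
  proof -
    obtain x where x: "config N x" "K N x \<le> (real N)\<^sup>2 * e + C2 * real N"
      "q * (\<Sum>i<N. (x i)\<^sup>2) \<le> C2 * real N" using C2(2)[OF N] by blast
    let ?h = "1 / real N ^ 3"
    define l where "l i = x i + ?h * real (i + 1)" for i
    have rN: "real N \<ge> 2" "N \<ge> 1" using N by auto
    have h: "0 < ?h" "?h \<le> 1" using rN by auto
    have errN: "real N \<le> err N" "real N * ln (real N) \<le> err N" using err_ge rN by auto
    have hN: "?h * (real N + 1) \<le> 2 / real N"
    proof -
      have "?h * (real N + 1) \<le> ?h * (2 * (real N * real N))" using h rN
        by (intro mult_left_mono) (auto intro: order_trans[of _ "2 * real N"])
      also have "\<dots> = 2 / real N" using rN by (simp add: power3_eq_cube)
      finally show ?thesis .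
    qed
    have lower: "exp (- ((real N)\<^sup>2 * e + C3 * err N)) \<le> weight N 1 \<alpha> \<gamma> b"
      if b: "\<And>i. i < N \<Longrightarrow> b i \<in> {l i..l i + ?h}" for b
    proof -
      have b': "x i + ?h * (real i + 1) \<le> b i" "b i \<le> x i + ?h * (real i + 2)" if "i < N" for i
        using b[OF that] by (auto simp: l_def algebra_simps add_divide_distrib)
      have pos: "0 \<le> ?h * real i" for i using h by simp
      have up: "x i + ?h \<le> b i" if "i < N" for i
        using b'(1)[OF that] pos[of i] unfolding distrib_left mult_1_right by linarith
      have shift: "\<bar>b i - x i\<bar> \<le> 2 / real N" if "i < N" for i
      proof -
        have "?h * (real i + 2) \<le> ?h * (real N + 1)" using that h by (intro mult_left_mono) auto
        then show ?thesis using b'(2)[OF that] up[OF that] hN h by linarith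
      qed
      have gap: "x j - x i \<le> b j - b i" if "i < j" "j < N" for i j
      proof -
        have "?h * (real i + 2) \<le> ?h * (real j + 1)" using that h by (intro mult_left_mono) auto
        then show ?thesis using b'(2)[of i] b'(1)[of j] that by linarith
      qed
      have "spread N x b"
        unfolding spread_def by (intro conjI allI impI gap shift up)
      note * = H_le_of_spread[OF x(1) N x(2,3) this, of 1 \<alpha> \<gamma>, folded C3_def]
      have "good N b" and H: "H N 1 \<alpha> \<gamma> b \<le> (real N)\<^sup>2 * e + C3 * err N"
        using s \<alpha> by (intro *; simp)+
      have "0 < b i" if "i < N" for i
      proof -
        have "0 \<le> x i" using x(1) s that unfolding config_def by blast
        then show ?thesis using up[OF that] h(1) by linarith
      qed
      with \<open>good N b\<close> have "weight N 1 \<alpha> \<gamma> b = exp (- H N 1 \<alpha> \<gamma> b)"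
        using s by (intro weight_eq_exp) auto
      then show ?thesis using H by simp
    qed
    let ?Z = "\<integral>a. weight N 1 \<alpha> \<gamma> a \<partial>(\<Pi>\<^sub>M i\<in>{..<N}. lborel)"
    have bd: "- ((real N)\<^sup>2 * e + C3 * err N) + real N * ln ?h \<le> ln ?Z"
      "ln ?Z \<le> - (real N)\<^sup>2 * e + C1 * err N + real N * ln g"
      unfolding g_def using lower q_pos
      by (intro ln_integral_bounds[where l = l and h = ?h and D = "- ((real N)\<^sup>2 * e + C3 * err N)",
            OF that(2) weight_nonneg h(1) _ C1(2)[OF N]]; (rule lower | simp); simp)+
    have "real N * ln g \<le> err N * \<bar>ln g\<bar>"
      using mult_left_mono[OF abs_ge_self[of "ln g"], of "real N"] mult_right_mono[OF errN(1), of "\<bar>ln g\<bar>"]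
        by simp
    moreover have "0 \<le> C1 * err N" "0 \<le> C3 * err N" "0 \<le> err N" "0 \<le> err N * \<bar>ln g\<bar>"
      using C1(1) C3 errN rN by auto
    moreover have "real N * ln ?h = - (3 * (real N * ln (real N)))" using rN by (simp add: ln_h)
    moreover have "(C1 + C3 + 3 + \<bar>ln g\<bar>) * err N = C1 * err N + C3 * err N + 3 * err N + err N * \<bar>ln g\<bar>"
      by (simp add: algebra_simps)
    ultimately show ?thesis
      using bd errN unfolding abs_le_iff by (simp only: mult_minus_left) linarith
  qed
  then show ?thesis by blast
qed

section \<open>The sum-zero hyperplane of type A\<close>

text \<open>Without the roots a_i + a_j the interaction depends on differences only, and \<kappa> =
  0; so only the quadratic potential notices a translation.\<close>

lemma K_translate:
  assumes "\<not> s"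
  shows "K N (\<lambda>i. x i - m) = K N x + real (N - 1) * q * (real N * m\<^sup>2 - 2 * m * (\<Sum>i<N. x i))"
proof -
  have 1: "V z = q * z\<^sup>2" for z unfolding V_def using kappa_zero[OF assms] by simp
  have 2: "L (y - m) (z - m) = L y z" for y z unfolding L_def using assms by simp
  have 3: "(\<Sum>i<N. q * (x i - m)\<^sup>2) = (\<Sum>i<N. q * (x i)\<^sup>2) + q * (real N * m\<^sup>2 - 2 * m * (\<Sum>i<N. x i))"
    by (simp add: power2_diff sum.distrib sum_subtractf sum_distrib_left algebra_simps)
  show ?thesis unfolding K_eq 1 2 3 by (simp only: distrib_left mult_ac)
qed

text \<open>Subtracting the mean m removes N m^2 from the sum of squares and, by
  \<open>K_translate\<close>, (N - 1) q N m^2 from \<open>K\<close>; centring therefore preserves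
  both bounds.\<close>

lemma exists_centred_near_minimiser:
  assumes "\<not> s"
  shows "\<exists>C\<ge>0. \<forall>N\<ge>2. \<exists>x. config N x \<and> K N x \<le> (real N)\<^sup>2 * e + C * real N \<and>
     q * (\<Sum>i<N. (x i)\<^sup>2) \<le> C * real N \<and> (\<Sum>i<N. x i) = 0"
proof -
  obtain C where C: "C \<ge> 0" "\<And>N. N \<ge> 2 \<Longrightarrow> \<exists>x. config N x \<and> K N x \<le> (real N)\<^sup>2 * e + C * real N \<and>
     q * (\<Sum>i<N. (x i)\<^sup>2) \<le> C * real N"
    using exists_near_minimiser by blast
  have "\<exists>x. config N x \<and> K N x \<le> (real N)\<^sup>2 * e + C * real N \<and>
     q * (\<Sum>i<N. (x i)\<^sup>2) \<le> C * real N \<and> (\<Sum>i<N. x i) = 0" if N: "N \<ge> 2" for N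
  proof -
    obtain x where x: "config N x" "K N x \<le> (real N)\<^sup>2 * e + C * real N" "q * (\<Sum>i<N. (x i)\<^sup>2) \<le> C * real N"
      using C(2)[OF N] by blast
    define m where "m = (\<Sum>i<N. x i) / real N"
    define y where "y i = x i - m" for i
    have sum: "(\<Sum>i<N. x i) = real N * m" using N by (simp add: m_def)
    have "config N y" using x(1) kappa_zero[OF assms] assms unfolding config_def y_def by simp
    moreover have "K N y \<le> K N x"
    proof -
      have "K N y = K N x - real (N - 1) * q * (real N * m\<^sup>2)"
        unfolding y_def K_translate[OF assms] sum by (simp add: power2_eq_square algebra_simps)
      then show ?thesis using q_pos by simp
    qed
    moreover have "q * (\<Sum>i<N. (y i)\<^sup>2) \<le> q * (\<Sum>i<N. (x i)\<^sup>2)"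
    proof -
      have "(\<Sum>i<N. (y i)\<^sup>2) = (\<Sum>i<N. (x i)\<^sup>2) - 2 * m * (\<Sum>i<N. x i) + real N * m\<^sup>2"
        by (simp add: y_def power2_diff sum.distrib sum_subtractf sum_distrib_left algebra_simps)
      also have "\<dots> = (\<Sum>i<N. (x i)\<^sup>2) - real N * m\<^sup>2" unfolding sum by (simp add: power2_eq_square)
      also have "\<dots> \<le> (\<Sum>i<N. (x i)\<^sup>2)" by simp
      finally show ?thesis using q_pos by simp
    qed
    moreover have "(\<Sum>i<N. y i) = 0" using sum by (simp add: y_def sum_subtractf)
    ultimately show ?thesis using x(2,3) by (meson order_trans)
  qed
  with C(1) show ?thesis by blast
qed

lemma ln_partition_hyperplane:
  assumes s: "\<not> s"
  shows "\<exists>C. \<forall>r\<ge>1. (\<lambda>b. weight (r + 1) 0 0 0 (b(r := - (\<Sum>i<r. b i)))) \<in> borel_measurable (\<Pi>\<^sub>M i\<in>{..<r}. lborel) \<longrightarrow>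
     \<bar>ln (sqrt (real r + 1) * (\<integral>b. weight (r + 1) 0 0 0 (b(r := - (\<Sum>i<r. b i))) \<partial>(\<Pi>\<^sub>M i\<in>{..<r}. lborel)))
        + (real (r + 1))\<^sup>2 * e\<bar> \<le> C * err (r + 1)"
proof -
  have "\<exists>C\<ge>0. \<forall>N\<ge>2. \<forall>p\<in>{0..1}. \<forall>a.
     weight N p 0 0 a \<le> exp (- (real N)\<^sup>2 * e + C * err N) * (\<Prod>i<N. exp (- (q / 8 * (a i)\<^sup>2)))"
    by (rule weight_le) auto
  then obtain C1 where C1: "C1 \<ge> 0" "\<And>N a. N \<ge> 2 \<Longrightarrow>
     weight N 0 0 0 a \<le> exp (- (real N)\<^sup>2 * e + C1 * err N) * (\<Prod>i<N. exp (- (q / 8 * (a i)\<^sup>2)))"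
    by (metis atLeastAtMost_iff order_refl zero_le_one)
  obtain C2 where C2: "C2 \<ge> 0" "\<And>N. N \<ge> 2 \<Longrightarrow> \<exists>x. config N x \<and> K N x \<le> (real N)\<^sup>2 * e + C2 * real N \<and>
     q * (\<Sum>i<N. (x i)\<^sup>2) \<le> C2 * real N \<and> (\<Sum>i<N. x i) = 0"
    using exists_centred_near_minimiser[OF s] by blast
  define C3 where "C3 = 6 * C2 + 12 * q + 3 * (\<kappa> + 0 + 0)"
  define g where "g = sqrt (pi / (q / 8))"
  have C3: "C3 \<ge> 0" using C2 q_pos kappa_nonneg by (simp add: C3_def)
  \<comment> \<open>Compared with the full space, 3 becomes 4 to absorb the logarithm of the Gram
    factor \<open>sqrt (real r + 1)\<close>.\<close>
  have "\<bar>ln (sqrt (real r + 1) * (\<integral>b. weight (r + 1) 0 0 0 (b(r := - (\<Sum>i<r. b i))) \<partial>(\<Pi>\<^sub>M i\<in>{..<r}. lborel)))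
        + (real (r + 1))\<^sup>2 * e\<bar> \<le> (C1 + C3 + 4 + \<bar>ln g\<bar>) * err (r + 1)"
    if r: "r \<ge> 1" and m: "(\<lambda>b. weight (r + 1) 0 0 0 (b(r := - (\<Sum>i<r. b i)))) \<in> borel_measurable (\<Pi>\<^sub>M i\<in>{..<r}. lborel)" for r
  proof -
    define N where "N = r + 1"
    have N: "N \<ge> 2" using r by (simp add: N_def)
    define emb where "emb b = b(r := - (\<Sum>i<r. b i))" for b :: "nat \<Rightarrow> real"
    obtain x where x: "config N x" "K N x \<le> (real N)\<^sup>2 * e + C2 * real N"
      "q * (\<Sum>i<N. (x i)\<^sup>2) \<le> C2 * real N" "(\<Sum>i<N. x i) = 0" using C2(2)[OF N] by blast
    let ?h = "1 / real N ^ 3"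
    \<comment> \<open>All points but the last move left, the leftmost most; the last moves right by the total.\<close>
    define l where "l i = x i - ?h * real (r - i)" for i
    have rN: "real N \<ge> 2" "N \<ge> 1" "real r = real N - 1" using N by (auto simp: N_def)
    have h: "0 < ?h" "?h \<le> 1" using rN by auto
    have errN: "real N \<le> err N" "real N * ln (real N) \<le> err N" using err_ge rN by auto
    \<comment> \<open>The last point absorbs r displacements of size up to r h, so it may move by
      r^2 h. This is what asks for a cubic power: intervals of length N^(-2) would move it by order
      1.\<close>
    have hN: "real r * (?h * real r) \<le> 2 / real N" "?h * real r \<le> 2 / real N"
    proof -
      have "real r * (?h * real r) \<le> real N * (?h * real N)" using rN h by (intro mult_mono) auto
      also have "\<dots> = 1 / real N" using rN by (simp add: power3_eq_cube)
      also have "\<dots> \<le> 2 / real N" using rN by (simp add: divide_right_mono)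
      finally show 1: "real r * (?h * real r) \<le> 2 / real N" .
      have "1 * (?h * real r) \<le> real r * (?h * real r)" using r h by (intro mult_right_mono) auto
      with 1 show "?h * real r \<le> 2 / real N" by linarith
    qed
    have lower: "exp (- ((real N)\<^sup>2 * e + C3 * err N)) \<le> weight N 0 0 0 (emb b)"
      if b: "\<And>i. i < r \<Longrightarrow> b i \<in> {l i..l i + ?h}" for b
    proof -
      have b': "x i - ?h * (real r - real i) \<le> b i" "b i \<le> x i - ?h * (real r - real i - 1)" if "i < r" for i
        using b[OF that] that
          by (auto simp: l_def of_nat_diff algebra_simps add_divide_distrib diff_divide_distrib)
      have neg: "b i \<le> x i" "x i - ?h * real r \<le> b i" if "i < r" for i
      proof -
        have "0 \<le> ?h * (real r - real i - 1)" using that h by (intro mult_nonneg_nonneg) auto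
        then show "b i \<le> x i" using b'(2)[OF that] by linarith
        have "?h * (real r - real i) \<le> ?h * real r" using h by (intro mult_left_mono) auto
        then show "x i - ?h * real r \<le> b i" using b'(1)[OF that] by linarith
      qed
      have last: "emb b r - x r = (\<Sum>i<r. x i - b i)"
        using x(4) by (simp add: emb_def N_def sum_subtractf)
      have last_nonneg: "0 \<le> (\<Sum>i<r. x i - b i)" using neg(1) by (intro sum_nonneg) auto
      have "(\<Sum>i<r. x i - b i) \<le> (\<Sum>i<r. ?h * real r)"
        using neg(2) by (intro sum_mono) (simp add: diff_le_eq add.commute)
      then have last_le: "(\<Sum>i<r. x i - b i) \<le> real r * (?h * real r)" by simp
      have eq: "emb b i = b i" if "i < r" for i using that by (simp add: emb_def)
      have shift: "\<bar>emb b i - x i\<bar> \<le> 2 / real N" if "i < N" for i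
      proof (cases "i = r")
        case True
        then show ?thesis unfolding True last using last_nonneg last_le hN(1) by linarith
      next
        case False
        then have "i < r" using that by (simp add: N_def)
        then show ?thesis using neg[of i] hN(2) eq[of i] by linarith
      qed
      have gap: "x j - x i \<le> emb b j - emb b i" if "i < j" "j < N" for i j
      proof (cases "j = r")
        case True
        then have "i < r" using that by simp
        then show ?thesis using neg(1)[of i] eq[of i] last last_nonneg unfolding True by linarith
      next
        case False
        then have ij: "i < r" "j < r" using that by (auto simp: N_def)
        have "?h * (real r - real j) \<le> ?h * (real r - real i - 1)"
          using that h by (intro mult_left_mono) auto
        then show ?thesis
          using b'(2)[OF ij(1)] b'(1)[OF ij(2)] eq[OF ij(1)] eq[OF ij(2)] by linarith
      qed
      have "spread N x (emb b)"
      proof -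
        have "s \<longrightarrow> (\<forall>i<N. x i + ?h \<le> emb b i)" using s by blast
        then show ?thesis unfolding spread_def by (intro conjI allI impI gap shift; blast)
      qed
      note * = H_le_of_spread[OF x(1) N x(2,3) this, of 0 0 0, folded C3_def]
      have "good N (emb b)" and H: "H N 0 0 0 (emb b) \<le> (real N)\<^sup>2 * e + C3 * err N"
        using s by (intro *; simp)+
      then have "weight N 0 0 0 (emb b) = exp (- H N 0 0 0 (emb b))"
        using s by (intro weight_eq_exp) auto
      then show ?thesis using H by simp
    qed
    have upper: "weight N 0 0 0 (emb b) \<le> exp (- (real N)\<^sup>2 * e + C1 * err N) * (\<Prod>i<r. exp (- (q / 8 * (b i)\<^sup>2)))" for b
    proof -
      have "weight N 0 0 0 (emb b) \<le> exp (- (real N)\<^sup>2 * e + C1 * err N) * (\<Prod>i<N. exp (- (q / 8 * (emb b i)\<^sup>2)))"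
        by (rule C1(2)[OF N])
      also have "(\<Prod>i<N. exp (- (q / 8 * (emb b i)\<^sup>2))) = (\<Prod>i<r. exp (- (q / 8 * (b i)\<^sup>2))) * exp (- (q / 8 * (emb b r)\<^sup>2))"
        by (simp add: N_def emb_def)
      \<comment> \<open>The factor of the dependent coordinate is at most 1; dropping it leaves a
        product over the r free coordinates.\<close>
      also have "\<dots> \<le> (\<Prod>i<r. exp (- (q / 8 * (b i)\<^sup>2))) * 1"
        using q_pos by (intro mult_left_mono prod_nonneg) auto
      finally show ?thesis by simp
    qed
    let ?Z = "\<integral>b. weight N 0 0 0 (emb b) \<partial>(\<Pi>\<^sub>M i\<in>{..<r}. lborel)"
    have m': "(\<lambda>b. weight N 0 0 0 (emb b)) \<in> borel_measurable (\<Pi>\<^sub>M i\<in>{..<r}. lborel)"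
      using m by (simp add: N_def emb_def)
    have bd: "0 < ?Z" "- ((real N)\<^sup>2 * e + C3 * err N) + real r * ln ?h \<le> ln ?Z"
      "ln ?Z \<le> - (real N)\<^sup>2 * e + C1 * err N + real r * ln g"
      unfolding g_def using lower q_pos
      by (intro ln_integral_bounds[where l = l and h = ?h and D = "- ((real N)\<^sup>2 * e + C3 * err N)",
            OF m' weight_nonneg h(1) _ upper]; (rule lower | simp); simp)+
    have "real r * ln g \<le> real r * \<bar>ln g\<bar>"
      using mult_left_mono[OF abs_ge_self[of "ln g"], of "real r"] by simp
    also have "\<dots> \<le> err N * \<bar>ln g\<bar>" using errN(1) rN by (intro mult_right_mono) auto
    finally have "real r * ln g \<le> err N * \<bar>ln g\<bar>" .
    moreover have "0 \<le> C1 * err N" "0 \<le> C3 * err N" "0 \<le> err N" "0 \<le> err N * \<bar>ln g\<bar>"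
      using C1(1) C3 errN rN by auto
    moreover have "real r * ln ?h \<ge> - (3 * err N)"
    proof -
      have "real r * ln (real N) \<le> real N * ln (real N)" using rN by (intro mult_right_mono) auto
      moreover have "real r * ln ?h = - (3 * (real r * ln (real N)))"
        using rN(2) by (simp add: ln_h)
      ultimately show ?thesis using errN(2) by linarith
    qed
    moreover have "ln (sqrt (real r + 1) * ?Z) = ln (sqrt (real N)) + ln ?Z"
    proof -
      have "real r + 1 = real N" using rN(3) by linarith
      moreover have "sqrt (real N) > 0" using rN(1) by simp
      ultimately show ?thesis using ln_mult_pos[OF _ bd(1), of "sqrt (real N)"] by metis
    qed
    moreover have "0 \<le> ln (sqrt (real N))" "ln (sqrt (real N)) \<le> err N"
    proof -
      have "ln (real N) \<le> real N" using rN ln_le_minus_one[of "real N"] by linarith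
      moreover have "0 \<le> ln (real N)" using rN by simp
      ultimately show "0 \<le> ln (sqrt (real N))" "ln (sqrt (real N)) \<le> err N"
        using rN errN(1) by (auto simp: ln_sqrt)
    qed
    moreover have "(C1 + C3 + 4 + \<bar>ln g\<bar>) * err N = C1 * err N + C3 * err N + 4 * err N + err N * \<bar>ln g\<bar>"
      by (simp add: algebra_simps)
    ultimately show ?thesis
      using bd
        unfolding N_def[symmetric] emb_def[symmetric] abs_le_iff by (simp only: mult_minus_left) linarith
  qed
  then show ?thesis by blast
qed

end

subsection \<open>The integrals of the symmetric spaces\<close>

text \<open>At x = 0 and n > 0 the power is 0 but the exponential is 1, by \<open>ls 0 = 0\<close>;
  for n = 0 both are 1.\<close>

lemma abs_sinh_power: "x \<noteq> 0 \<or> n = 0 \<Longrightarrow> \<bar>sinh x\<bar> ^ n = exp (real n * ls x)"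
  by (auto simp: ls_def exp_of_nat_mult)

lemma prod_pairs_eq_0:
  fixes f :: "nat \<Rightarrow> nat \<Rightarrow> real"
  assumes "i < j" "j < N" "f i j = 0"
  shows "(\<Prod>j<N. \<Prod>i<j. f i j) = 0"
proof -
  have "(\<Prod>i<j. f i j) = 0" using assms by (intro prod_zero) auto
  then show ?thesis using assms(2) by (intro prod_zero) auto
qed

lemma prod_pairs_exp:
  fixes f :: "nat \<Rightarrow> nat \<Rightarrow> real"
  assumes "\<And>i j. i < j \<Longrightarrow> j < N \<Longrightarrow> f i j = exp (g i j)"
  shows "(\<Prod>j<N. \<Prod>i<j. f i j) = exp (\<Sum>j<N. \<Sum>i<j. g i j)"
  using assms by (simp add: exp_sum)

context log_gas
begin

lemma not_good:
  assumes "\<not> good N a"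
  obtains i j where "i < j" "j < N" "\<not> nonsing (a i) (a j)"
proof -
  obtain i j where ij: "i < N" "j < N" "i \<noteq> j" "\<not> nonsing (a i) (a j)"
    using assms unfolding good_def by blast
  have "\<not> nonsing (a j) (a i)" using ij(4) unfolding nonsing_def by (auto simp: add.commute)
  with ij that show ?thesis by (metis nat_neq_iff)
qed

text \<open>The Gaussian factor and the \<kappa> N powers of sinh (a i) together make N copies of
  \<open>V\<close>: N - 1 belong to \<open>K\<close>, the last is \<open>p = 1\<close>, and the
  powers \<alpha> and \<open>nc\<close> remain. The case distinctions match the zeros of the product
  with those built into \<open>weight\<close>.\<close>

lemma full_density_eq_weight:
  assumes s: s and N: "N \<ge> 2" and b: "\<beta> = real nb" and a: "real na = \<kappa> * real N + \<alpha>" "\<alpha> \<ge> 0"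
  shows "exp (- (q * real N * (\<Sum>i<N. (a i)\<^sup>2))) *
      ((\<Prod>j<N. \<Prod>i<j. \<bar>sinh (a i - a j) * sinh (a i + a j)\<bar> ^ nb) *
       (\<Prod>i<N. \<bar>sinh (a i)\<bar> ^ na * \<bar>sinh (2 * a i)\<bar> ^ nc)) = weight N 1 \<alpha> (real nc) a"
    (is "?g * (?P * ?Q) = _")
proof -
  have nb: "nb > 0" using b beta_pos by simp
  have na: "na > 0" if "\<kappa> \<noteq> 0"
  proof -
    have "\<kappa> * real N > 0" using that kappa_nonneg N by simp
    then have "real na > 0" using a by linarith
    then show ?thesis by simp
  qed
  have Q0: "?Q = 0" if "i < N" "a i = 0" "na > 0 \<or> nc > 0" for i
    using that by (auto intro!: bexI[of _ i])
  show ?thesis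
  proof (cases "good N a \<and> (\<alpha> + real nc > 0 \<longrightarrow> (\<forall>i<N. a i \<noteq> 0))")
    case False
    have "?P * ?Q = 0"
    proof (cases "good N a")
      case True
      then obtain i where i: "i < N" "a i = 0" "\<alpha> + real nc > 0" using False by blast
      have "na > 0 \<or> nc > 0"
      proof (rule ccontr)
        assume "\<not> ?thesis"
        then have "real na = 0" "\<alpha> > 0" using i(3) by auto
        moreover have "\<kappa> * real N \<ge> 0" using kappa_nonneg by simp
        ultimately show False using a(1) by linarith
      qed
      then show ?thesis using Q0 i by simp
    next
      case False
      then obtain i j where ij: "i < j" "j < N" "\<not> nonsing (a i) (a j)" by (rule not_good)
      then consider "a i = a j \<or> a i + a j = 0" | "\<kappa> \<noteq> 0" "a i = 0 \<or> a j = 0"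
        unfolding nonsing_def by blast
      then show ?thesis
      proof cases
        case 1
        then have "?P = 0" using ij nb by (intro prod_pairs_eq_0[of i j]) auto
        then show ?thesis by simp
      next
        case 2
        then show ?thesis using Q0[of i] Q0[of j] ij na by auto
      qed
    qed
    then show ?thesis unfolding weight_def if_not_P[OF False] by (simp only: mult_zero_right)
  next
    case True
    have ns: "a i - a j \<noteq> 0" "a i + a j \<noteq> 0" if "i < j" "j < N" for i j
    proof -
      have "nonsing (a i) (a j)" using True that unfolding good_def by auto
      then show "a i - a j \<noteq> 0" "a i + a j \<noteq> 0" using s unfolding nonsing_def by auto
    qed
    have "?P = exp (\<Sum>j<N. \<Sum>i<j. \<beta> * L (a i) (a j))"
    proof (rule prod_pairs_exp)
      fix i j :: nat assume "i < j" "j < N"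
      then have "\<bar>sinh (a i - a j) * sinh (a i + a j)\<bar> ^ nb = exp (real nb * ls (a i - a j)) * exp (real nb * ls (a i + a j))"
        using ns by (simp only: abs_mult power_mult_distrib abs_sinh_power simp_thms)
      also have "\<dots> = exp (\<beta> * L (a i) (a j))"
        unfolding L_def if_P[OF s] b by (simp add: exp_add distrib_left)
      finally show "\<bar>sinh (a i - a j) * sinh (a i + a j)\<bar> ^ nb = exp (\<beta> * L (a i) (a j))" .
    qed
    also have "(\<Sum>j<N. \<Sum>i<j. \<beta> * L (a i) (a j)) = \<beta> * (\<Sum>j<N. \<Sum>i<j. L (a i) (a j))"
      by (simp only: sum_distrib_left)
    finally have P: "?P = exp (\<beta> * (\<Sum>j<N. \<Sum>i<j. L (a i) (a j)))" .
    have "\<bar>sinh (a i)\<bar> ^ na * \<bar>sinh (2 * a i)\<bar> ^ nc = exp (real na * ls (a i) + real nc * ls (2 * a i))"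
      if i: "i < N" for i
    proof -
      have "a i \<noteq> 0 \<or> na = 0 \<and> nc = 0"
      proof (cases "\<kappa> = 0 \<and> \<alpha> + real nc = 0")
        case True
        then have "real na = 0" "real nc = 0" using a by auto
        then show ?thesis by simp
      next
        case False
        have "a i \<noteq> 0"
        proof (cases "\<kappa> = 0")
          case True
          then have "\<alpha> + real nc > 0" using False a(2) by (simp add: order_less_le)
          then show ?thesis using \<open>good N a \<and> _\<close> i by blast
        next
          case False
          have "nonsing (a i) (a (if i = 0 then 1 else 0))"
            using \<open>good N a \<and> _\<close> i N unfolding good_def by auto
          then show ?thesis using False unfolding nonsing_def by blast
        qed
        then show ?thesis ..
      qed
      then show ?thesis by (auto simp: abs_sinh_power exp_add)
    qed
    then have "?Q = exp (\<Sum>i<N. real na * ls (a i) + real nc * ls (2 * a i))"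
      by (simp add: exp_sum)
    also have "(\<Sum>i<N. real na * ls (a i) + real nc * ls (2 * a i))
       = real na * (\<Sum>i<N. ls (a i)) + real nc * (\<Sum>i<N. ls (2 * a i))"
      by (simp only: sum.distrib sum_distrib_left)
    finally have Q: "?Q = exp (real na * (\<Sum>i<N. ls (a i)) + real nc * (\<Sum>i<N. ls (2 * a i)))" .
    have V: "(\<Sum>i<N. V (a i)) = q * (\<Sum>i<N. (a i)\<^sup>2) - \<kappa> * (\<Sum>i<N. ls (a i))"
      by (simp only: V_def sum_subtractf sum_distrib_left)
    have "real (N - 1) = real N - 1" using N by simp
    then have "- H N 1 \<alpha> (real nc) a = - (q * real N * (\<Sum>i<N. (a i)\<^sup>2)) + (\<beta> * (\<Sum>j<N. \<Sum>i<j. L (a i) (a j))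
        + (real na * (\<Sum>i<N. ls (a i)) + real nc * (\<Sum>i<N. ls (2 * a i))))"
      unfolding H_def K_eq V a(1) by (simp add: algebra_simps)
    then show ?thesis unfolding P Q weight_def if_P[OF True] by (simp only: exp_add)
  qed
qed

text \<open>With r + 1 points the Gaussian coefficient q r is exactly the one in \<open>K\<close>,
  hence \<open>p = 0\<close>.\<close>

lemma hyperplane_density_eq_weight:
  assumes s: "\<not> s" and b: "\<beta> = real nb"
  shows "exp (- (q * real r * (\<Sum>i<r + 1. (a i)\<^sup>2))) *
      (\<Prod>j<r + 1. \<Prod>i<j. \<bar>sinh (a i - a j)\<bar> ^ nb) = weight (r + 1) 0 0 0 a"
    (is "?g * ?P = _")
proof -
  have nb: "nb > 0" using b beta_pos by simp
  have k0: "\<kappa> = 0" using kappa_zero s by blast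
  show ?thesis
  proof (cases "good (r + 1) a")
    case False
    then obtain i j where ij: "i < j" "j < r + 1" "\<not> nonsing (a i) (a j)" by (rule not_good)
    then have "a i = a j" using s k0 unfolding nonsing_def by blast
    then have "?P = 0" using ij nb by (intro prod_pairs_eq_0[of i j]) auto
    then show ?thesis using False unfolding weight_def by simp
  next
    case True
    have "?P = exp (\<Sum>j<r + 1. \<Sum>i<j. \<beta> * L (a i) (a j))"
    proof (rule prod_pairs_exp)
      fix i j :: nat assume ij: "i < j" "j < r + 1"
      then have "a i - a j \<noteq> 0" using True unfolding good_def nonsing_def by auto
      then show "\<bar>sinh (a i - a j)\<bar> ^ nb = exp (\<beta> * L (a i) (a j))"
        unfolding L_def if_not_P[OF s] b by (simp add: abs_sinh_power)
    qed
    also have "(\<Sum>j<r + 1. \<Sum>i<j. \<beta> * L (a i) (a j)) = \<beta> * (\<Sum>j<r + 1. \<Sum>i<j. L (a i) (a j))"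
      by (simp only: sum_distrib_left)
    finally have P: "?P = exp (\<beta> * (\<Sum>j<r + 1. \<Sum>i<j. L (a i) (a j)))" .
    have V: "(\<Sum>i<r + 1. V (a i)) = q * (\<Sum>i<r + 1. (a i)\<^sup>2)"
      unfolding V_def sum_distrib_left using k0 by simp
    have "- H (r + 1) 0 0 0 a = - (q * real r * (\<Sum>i<r + 1. (a i)\<^sup>2)) + \<beta> * (\<Sum>j<r + 1. \<Sum>i<j. L (a i) (a j))"
      unfolding H_def K_eq V by simp
    then show ?thesis unfolding P weight_def using True by (simp only: exp_add) simp
  qed
qed

end

text \<open>Absent roots have multiplicity 0 and contribute a zeroth power, so one formula serves
  types B, C, D and BC.\<close>

lemma Z_flat_full:
  fixes c \<sigma> :: real
  assumes "root_type R \<noteq> Type_A" "root_type R \<in> {Type_C, Type_D} \<longrightarrow> mult_alpha R = 0"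
    "root_type R \<in> {Type_B, Type_D} \<longrightarrow> mult_gamma R = 0"
  defines "N \<equiv> root_rank R"
  defines "f \<equiv> \<lambda>a. exp (- (c / (2 * \<sigma>\<^sup>2)) * (\<Sum>i<N. (a i)\<^sup>2)) *
      ((\<Prod>j<N. \<Prod>i<j. \<bar>sinh (a i - a j) * sinh (a i + a j)\<bar> ^ mult_beta R) *
       (\<Prod>i<N. \<bar>sinh (a i)\<bar> ^ mult_alpha R * \<bar>sinh (2 * a i)\<bar> ^ mult_gamma R))"
  shows "Z_flat c R \<sigma> = (\<integral>a. f a \<partial>(\<Pi>\<^sub>M i\<in>{..<N}. lborel))"
    and "f \<in> borel_measurable (\<Pi>\<^sub>M i\<in>{..<N}. lborel)"
proof -
  have "root_density R a = (\<Prod>j<N. \<Prod>i<j. \<bar>sinh (a i - a j) * sinh (a i + a j)\<bar> ^ mult_beta R) *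
       (\<Prod>i<N. \<bar>sinh (a i)\<bar> ^ mult_alpha R * \<bar>sinh (2 * a i)\<bar> ^ mult_gamma R)" for a
    using assms(1-3)
      by (cases "root_type R") (simp_all add: root_density_def num_coords_def N_def Let_def)
  then show "Z_flat c R \<sigma> = (\<integral>a. f a \<partial>(\<Pi>\<^sub>M i\<in>{..<N}. lborel))"
    using assms(1) by (simp add: Z_flat_def f_def flat_measure_def num_coords_def N_def Let_def)
  have [measurable]: "(\<lambda>a. a i) \<in> borel_measurable (\<Pi>\<^sub>M i\<in>{..<N}. lborel)" if "i < N" for i
    using measurable_component_singleton[of i "{..<N}" "\<lambda>_. lborel"] that by simp
  show "f \<in> borel_measurable (\<Pi>\<^sub>M i\<in>{..<N}. lborel)"
    unfolding f_def
    by (intro borel_measurable_times borel_measurable_prod borel_measurable_exp borel_measurable_sum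
        borel_measurable_power borel_measurable_abs borel_measurable_sinh borel_measurable_add
        borel_measurable_diff borel_measurable_const) auto
qed

text \<open>The scaling and the image measure are unfolded under \<open>nn_integral\<close>. As the
  density is nonnegative, both sides are \<open>enn2real\<close> of such integrals whether these are
  finite or not.\<close>

lemma Z_flat_hyperplane:
  fixes c \<sigma> :: real
  assumes "root_type R = Type_A"
  defines "r \<equiv> root_rank R"
  defines "f \<equiv> \<lambda>a. exp (- (c / (2 * \<sigma>\<^sup>2)) * (\<Sum>i<r + 1. (a i)\<^sup>2)) *
      (\<Prod>j<r + 1. \<Prod>i<j. \<bar>sinh (a i - a j)\<bar> ^ mult_beta R)"
  shows "Z_flat c R \<sigma> = sqrt (real r + 1) * (\<integral>b. f (b(r := - (\<Sum>i<r. b i))) \<partial>(\<Pi>\<^sub>M i\<in>{..<r}. lborel))"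
    and "(\<lambda>b. f (b(r := - (\<Sum>i<r. b i)))) \<in> borel_measurable (\<Pi>\<^sub>M i\<in>{..<r}. lborel)"
proof -
  let ?M = "\<Pi>\<^sub>M i\<in>{..<r}. (lborel :: real measure)" and ?M1 = "\<Pi>\<^sub>M i\<in>{..<r + 1}. (lborel :: real measure)"
  let ?\<phi> = "\<lambda>b::nat \<Rightarrow> real. b(r := - (\<Sum>i<r. b i))"
  have comp: "(\<lambda>a. a i) \<in> borel_measurable (\<Pi>\<^sub>M i\<in>{..<n}. (lborel :: real measure))" if "i < n" for i n
    using measurable_component_singleton[of i "{..<n}" "\<lambda>_. lborel"] that by simp
  have f: "f \<in> borel_measurable ?M1"
    unfolding f_def
    by (intro borel_measurable_times borel_measurable_prod borel_measurable_exp borel_measurable_sum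
        borel_measurable_power borel_measurable_abs borel_measurable_sinh
        borel_measurable_diff borel_measurable_const comp) auto
  have "(\<lambda>b. - (\<Sum>i<r. b i)) \<in> borel_measurable ?M"
    by (intro borel_measurable_uminus borel_measurable_sum comp) auto
  then have \<phi>: "?\<phi> \<in> measurable ?M ?M1"
    by (intro measurable_fun_upd[of _ "{..<r}"]) auto
  from measurable_compose[OF \<phi> f] show f\<phi>: "(\<lambda>b. f (?\<phi> b)) \<in> borel_measurable ?M" .
  have nonneg: "0 \<le> f a" for a by (auto simp: f_def intro!: mult_nonneg_nonneg prod_nonneg)
  have flat: "flat_measure R = scale_measure (ennreal (sqrt (real r + 1))) (distr ?M ?M1 ?\<phi>)"
    using assms(1) by (simp add: flat_measure_def r_def Let_def)
  have "Z_flat c R \<sigma> = (\<integral>a. f a \<partial>flat_measure R)"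
    using assms(1) by (simp add: Z_flat_def f_def root_density_def num_coords_def r_def Let_def)
  also have "\<dots> = enn2real (\<integral>\<^sup>+a. ennreal (f a) \<partial>flat_measure R)"
    using f nonneg
      by (intro integral_eq_nn_integral) (simp_all add: flat measurable_def space_scale_measure)
  also have "(\<integral>\<^sup>+a. ennreal (f a) \<partial>flat_measure R)
      = ennreal (sqrt (real r + 1)) * (\<integral>\<^sup>+b. ennreal (f (?\<phi> b)) \<partial>?M)"
    unfolding flat using f \<phi> by (subst nn_integral_scale_measure) (auto simp: nn_integral_distr)
  also have "enn2real \<dots> = sqrt (real r + 1) * enn2real (\<integral>\<^sup>+b. ennreal (f (?\<phi> b)) \<partial>?M)"
    by (simp add: enn2real_mult)
  also have "enn2real (\<integral>\<^sup>+b. ennreal (f (?\<phi> b)) \<partial>?M) = (\<integral>b. f (?\<phi> b) \<partial>?M)"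
    using f\<phi> nonneg by (intro integral_eq_nn_integral[symmetric]) auto
  finally show "Z_flat c R \<sigma> = sqrt (real r + 1) * (\<integral>b. f (?\<phi> b) \<partial>?M)" .
qed

section \<open>From bounds at finite rank to the limits\<close>

lemma roots_of_mult:
  assumes "irreducible_noncompact m"
  shows "mult_beta (roots_of m) > 0"
    "root_type (roots_of m) \<in> {Type_C, Type_D} \<longrightarrow> mult_alpha (roots_of m) = 0"
    "root_type (roots_of m) \<in> {Type_B, Type_D} \<longrightarrow> mult_gamma (roots_of m) = 0"
  by (cases m; simp split: if_splits)+

text \<open>\<open>d\<close> is the number of points minus the rank: 1 for type A, 0 otherwise. A
  fixed shift does not change the limit of the quotient of squares, and \<open>err\<close> is of
  smaller order than the square.\<close>

lemma log_limit:
  assumes "filterlim \<rho> at_top sequentially"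
    and bound: "\<And>n. \<rho> n \<ge> 2 \<Longrightarrow> \<bar>ln (Z n) + (real (\<rho> n + d))\<^sup>2 * e\<bar> \<le> C * err (\<rho> n + d)"
  shows "(\<lambda>n. ereal (1 / (real (\<rho> n))\<^sup>2 * ln (Z n))) \<longlonglongrightarrow> ereal (- e)"
proof -
  have 1: "((\<lambda>x::nat. (real (x + d))\<^sup>2 / (real x)\<^sup>2) \<longlongrightarrow> 1) at_top"
    by real_asymp
  have 2: "((\<lambda>x::nat. err (x + d) / (real x)\<^sup>2) \<longlongrightarrow> 0) at_top"
    unfolding err_def by real_asymp
  note 1 = filterlim_compose[OF 1 assms(1)] and 2 = filterlim_compose[OF 2 assms(1)]
  have "((\<lambda>n. (ln (Z n) + (real (\<rho> n + d))\<^sup>2 * e) / (real (\<rho> n))\<^sup>2) \<longlongrightarrow> 0) sequentially"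
  proof (rule tendsto_0_le[OF tendsto_mult_right_zero[OF 2, of C], of _ 1])
    have "eventually (\<lambda>n. \<rho> n \<ge> 2) sequentially"
      using assms(1) by (simp add: filterlim_at_top)
    then show "\<forall>\<^sub>F n in sequentially. norm ((ln (Z n) + (real (\<rho> n + d))\<^sup>2 * e) / (real (\<rho> n))\<^sup>2)
        \<le> norm (C * (err (\<rho> n + d) / (real (\<rho> n))\<^sup>2)) * 1"
    proof eventually_elim
      case (elim n)
      have "\<bar>ln (Z n) + (real (\<rho> n + d))\<^sup>2 * e\<bar> \<le> \<bar>C * err (\<rho> n + d)\<bar>"
        using bound[OF elim] by linarith
      then show ?case by (simp add: abs_mult divide_right_mono)
    qed
  qed
  from tendsto_diff[OF this tendsto_mult_right[OF 1, of e]]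
  have "(\<lambda>n. (ln (Z n) + (real (\<rho> n + d))\<^sup>2 * e) / (real (\<rho> n))\<^sup>2 - (real (\<rho> n + d))\<^sup>2 / (real (\<rho> n))\<^sup>2 * e) \<longlonglongrightarrow> - e"
    by simp
  then have "(\<lambda>n. 1 / (real (\<rho> n))\<^sup>2 * ln (Z n)) \<longlonglongrightarrow> - e"
    by (simp add: add_divide_distrib)
  then show ?thesis by simp
qed

text \<open>At \<delta> = 1 the logarithm has coefficient 0, and its product with
  \<open>log_sinh x\<close> is 0 in \<open>ereal\<close> even at x = 0.\<close>

lemma E_BC_1: "E_BC c t \<beta> 1 = E_C c t \<beta>"
  by (simp add: E_BC_def E_C_def I_BC_def I_C_def zero_ereal_def[symmetric])

lemma log_gas_A: "c > 0 \<Longrightarrow> t > 0 \<Longrightarrow> \<beta> > 0 \<Longrightarrow> log_gas (c / (2 * t)) \<beta> 0 False"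
  by unfold_locales auto

lemma log_gas_BC: "c > 0 \<Longrightarrow> t > 0 \<Longrightarrow> \<beta> > 0 \<Longrightarrow> \<delta> \<ge> 1 \<Longrightarrow> log_gas (c / (2 * t)) \<beta> (\<beta> * (\<delta> - 1)) True"
  by unfold_locales auto

lemma E_A_eq:
  assumes "c > 0" "t > 0" "\<beta> > 0"
  shows "E_A c t \<beta> = log_gas.E (c / (2 * t)) \<beta> 0 False"
proof -
  interpret log_gas "c / (2 * t)" \<beta> 0 False using assms by (rule log_gas_A)
  show ?thesis by (simp add: E_A_def E_def I_A_def I_def zero_ereal_def[symmetric])
qed

lemma E_BC_eq:
  assumes "c > 0" "t > 0" "\<beta> > 0" "\<delta> \<ge> 1"
  shows "E_BC c t \<beta> \<delta> = log_gas.E (c / (2 * t)) \<beta> (\<beta> * (\<delta> - 1)) True"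
proof -
  interpret log_gas "c / (2 * t)" \<beta> "\<beta> * (\<delta> - 1)" True using assms by (rule log_gas_BC)
  show ?thesis by (simp add: E_BC_def E_def I_BC_def I_def)
qed

lemma has_log_limit_A:
  assumes "c > 0" "t > 0" "large_rank_sequence t \<beta> \<gamma> M \<sigma>"
    and A: "\<And>n. root_type (roots_of (M n)) = Type_A"
  shows "has_log_limit c M \<sigma> (- E_A c t (real \<beta>))"
proof -
  define \<rho> where "\<rho> n = root_rank (roots_of (M n))" for n
  have M: "irreducible_noncompact (M n)" "mult_beta (roots_of (M n)) = \<beta>" "\<sigma> n > 0" "t = real (\<rho> n) * (\<sigma> n)\<^sup>2" for n
    using assms(3) unfolding large_rank_sequence_def \<rho>_def by auto
  have lim: "filterlim \<rho> at_top sequentially"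
    using assms(3) unfolding large_rank_sequence_def \<rho>_def by auto
  have "\<beta> > 0" using roots_of_mult(1)[OF M(1)] M(2) by metis
  then interpret log_gas "c / (2 * t)" "real \<beta>" 0 False using assms by (intro log_gas_A) auto
  obtain C where C: "\<And>r. r \<ge> 1 \<Longrightarrow> (\<lambda>b. weight (r + 1) 0 0 0 (b(r := - (\<Sum>i<r. b i)))) \<in> borel_measurable (\<Pi>\<^sub>M i\<in>{..<r}. lborel) \<Longrightarrow>
     \<bar>ln (sqrt (real r + 1) * (\<integral>b. weight (r + 1) 0 0 0 (b(r := - (\<Sum>i<r. b i))) \<partial>(\<Pi>\<^sub>M i\<in>{..<r}. lborel)))
        + (real (r + 1))\<^sup>2 * e\<bar> \<le> C * err (r + 1)"
    using ln_partition_hyperplane by blast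
  have "(\<lambda>n. ereal (1 / (real (\<rho> n))\<^sup>2 * ln (Z_flat c (roots_of (M n)) (\<sigma> n)))) \<longlonglongrightarrow> ereal (- e)"
  proof (rule log_limit[OF lim])
    fix n assume n: "\<rho> n \<ge> 2"
    \<comment> \<open>t = r \<sigma>^2 makes the Gaussian coefficient q times the rank.\<close>
    have "c / (2 * (\<sigma> n)\<^sup>2) = c / (2 * t) * real (\<rho> n)"
      unfolding M(4)[of n] using M(3)[of n] n by simp
    then have w: "exp (- (c / (2 * (\<sigma> n)\<^sup>2)) * (\<Sum>i<\<rho> n + 1. (a i)\<^sup>2)) *
      (\<Prod>j<\<rho> n + 1. \<Prod>i<j. \<bar>sinh (a i - a j)\<bar> ^ \<beta>) = weight (\<rho> n + 1) 0 0 0 a" for a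
      using hyperplane_density_eq_weight[of \<beta> "\<rho> n" a] by (simp only: mult_minus_left simp_thms)
    note Z = Z_flat_hyperplane[OF A[of n], of c "\<sigma> n", unfolded M(2), folded \<rho>_def, unfolded w]
    show "\<bar>ln (Z_flat c (roots_of (M n)) (\<sigma> n)) + (real (\<rho> n + 1))\<^sup>2 * e\<bar> \<le> C * err (\<rho> n + 1)"
      unfolding Z(1) using n by (intro C Z(2)) simp
  qed
  then show ?thesis
    unfolding has_log_limit_def \<rho>_def[symmetric]
      using E_A_eq[of c t "real \<beta>"] assms(1,2) \<open>\<beta> > 0\<close> by (simp add: E_eq)
qed

text \<open>The multiplicity of a_i splits into a part proportional to the rank, which enters the
  energy, and a bounded remainder \<open>\<alpha>'\<close>, which disappears in the limit. This
  treats linear and constant multiplicities together.\<close>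

lemma has_log_limit_BC:
  assumes "c > 0" "t > 0" "\<delta> \<ge> 1" "large_rank_sequence t \<beta> \<gamma> M \<sigma>"
    and A: "\<And>n. root_type (roots_of (M n)) \<noteq> Type_A"
    and \<alpha>: "\<And>n. real (mult_alpha (roots_of (M n))) = real \<beta> * (\<delta> - 1) * real (root_rank (roots_of (M n))) + \<alpha>' n"
    and \<alpha>': "\<And>n. \<alpha>' n \<in> {0, 4}"
  shows "has_log_limit c M \<sigma> (- E_BC c t (real \<beta>) \<delta>)"
proof -
  define \<rho> where "\<rho> n = root_rank (roots_of (M n))" for n
  have M: "irreducible_noncompact (M n)" "mult_beta (roots_of (M n)) = \<beta>" "\<sigma> n > 0"
      "t = real (\<rho> n) * (\<sigma> n)\<^sup>2" "mult_gamma (roots_of (M n)) = \<gamma>" for n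
    using assms(4) unfolding large_rank_sequence_def \<rho>_def by auto
  have lim: "filterlim \<rho> at_top sequentially"
    using assms(4) unfolding large_rank_sequence_def \<rho>_def by auto
  have "\<beta> > 0" using roots_of_mult(1)[OF M(1)] M(2) by metis
  then interpret log_gas "c / (2 * t)" "real \<beta>" "real \<beta> * (\<delta> - 1)" True
    using assms by (intro log_gas_BC) auto
  have "\<exists>C. \<forall>N\<ge>2. weight N 1 x (real \<gamma>) \<in> borel_measurable (\<Pi>\<^sub>M i\<in>{..<N}. lborel) \<longrightarrow>
     \<bar>ln (\<integral>a. weight N 1 x (real \<gamma>) a \<partial>(\<Pi>\<^sub>M i\<in>{..<N}. lborel)) + (real N)\<^sup>2 * e\<bar> \<le> C * err N" if "x \<ge> 0" for x
    using that by (intro ln_partition_full_space) auto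
  then obtain C where C: "\<And>x N. x \<ge> 0 \<Longrightarrow> N \<ge> 2 \<Longrightarrow> weight N 1 x (real \<gamma>) \<in> borel_measurable (\<Pi>\<^sub>M i\<in>{..<N}. lborel) \<Longrightarrow>
     \<bar>ln (\<integral>a. weight N 1 x (real \<gamma>) a \<partial>(\<Pi>\<^sub>M i\<in>{..<N}. lborel)) + (real N)\<^sup>2 * e\<bar> \<le> C x * err N"
    by metis
  have "(\<lambda>n. ereal (1 / (real (\<rho> n))\<^sup>2 * ln (Z_flat c (roots_of (M n)) (\<sigma> n)))) \<longlonglongrightarrow> ereal (- e)"
  proof (rule log_limit[OF lim, where d = 0])
    fix n assume n: "\<rho> n \<ge> 2"
    have a: "\<alpha>' n \<ge> 0" using \<alpha>'[of n] by auto
    let ?w = "\<lambda>a. exp (- (c / (2 * (\<sigma> n)\<^sup>2)) * (\<Sum>i<\<rho> n. (a i)\<^sup>2)) *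
      ((\<Prod>j<\<rho> n. \<Prod>i<j. \<bar>sinh (a i - a j) * sinh (a i + a j)\<bar> ^ \<beta>) *
       (\<Prod>i<\<rho> n. \<bar>sinh (a i)\<bar> ^ mult_alpha (roots_of (M n)) * \<bar>sinh (2 * a i)\<bar> ^ \<gamma>))"
    have "c / (2 * (\<sigma> n)\<^sup>2) = c / (2 * t) * real (\<rho> n)"
      unfolding M(4)[of n] using M(3)[of n] n by simp
    then have w: "?w = weight (\<rho> n) 1 (\<alpha>' n) (real \<gamma>)"
      using full_density_eq_weight[OF _ n _ \<alpha>[of n, folded \<rho>_def] a, of \<beta> _ \<gamma>]
      by (intro ext) (simp only: mult_minus_left simp_thms)
    note Z = Z_flat_full[OF A[of n] roots_of_mult(2,3)[OF M(1)], of c "\<sigma> n", unfolded M(2,5), folded \<rho>_def, unfolded w]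
    have "\<bar>ln (Z_flat c (roots_of (M n)) (\<sigma> n)) + (real (\<rho> n))\<^sup>2 * e\<bar> \<le> C (\<alpha>' n) * err (\<rho> n)"
      unfolding Z(1) by (rule C[OF a n Z(2)])
    \<comment> \<open>The constant depends on the remainder; as this takes only two values, one
      constant serves for all \<open>n\<close>.\<close>
    also have "\<dots> \<le> max (C 0) (C 4) * err (\<rho> n)"
      using \<alpha>'[of n] err_ge(1)[of "\<rho> n"] n by (intro mult_right_mono) auto
    finally show "\<bar>ln (Z_flat c (roots_of (M n)) (\<sigma> n)) + (real (\<rho> n + 0))\<^sup>2 * e\<bar> \<le> max (C 0) (C 4) * err (\<rho> n + 0)"
      by simp
  qed
  then show ?thesis
    unfolding has_log_limit_def \<rho>_def[symmetric]
      using E_BC_eq[of c t "real \<beta>" \<delta>] assms(1-3) \<open>\<beta> > 0\<close> by (simp add: E_eq)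
qed

theorem proposition4:
  fixes c t :: real
  assumes "c > 0" and "t > 0"
  shows "(\<forall>\<beta>>0. \<bar>E_A c t \<beta>\<bar> \<noteq> \<infinity> \<and> \<bar>E_C c t \<beta>\<bar> \<noteq> \<infinity> \<and> (\<forall>\<delta>\<ge>1. \<bar>E_BC c t \<beta> \<delta>\<bar> \<noteq> \<infinity>)) \<and>
    (\<forall>M \<sigma> \<beta> \<gamma>. large_rank_sequence t \<beta> \<gamma> M \<sigma> \<longrightarrow>
      ((\<forall>n. root_type (roots_of (M n)) = Type_A) \<longrightarrow>
         has_log_limit c M \<sigma> (- E_A c t (real \<beta>))) \<and>
      (\<forall>\<delta>\<ge>1. (\<forall>n. root_type (roots_of (M n)) \<in> {Type_B, Type_D} \<and>
             real (mult_alpha (roots_of (M n)))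
               = real \<beta> * (\<delta> - 1) * real (root_rank (roots_of (M n)))) \<longrightarrow>
         has_log_limit c M \<sigma> (- E_BC c t (real \<beta>) \<delta>)) \<and>
      ((\<forall>n. root_type (roots_of (M n)) \<in> {Type_C, Type_D}) \<longrightarrow>
         has_log_limit c M \<sigma> (- E_C c t (real \<beta>))) \<and>
      (\<forall>\<delta>\<ge>1. (\<forall>n. root_type (roots_of (M n)) \<in> {Type_BC, Type_C} \<and>
             real (mult_alpha (roots_of (M n)))
               = real \<beta> * (\<delta> - 1) * real (root_rank (roots_of (M n)))) \<longrightarrow>
         has_log_limit c M \<sigma> (- E_BC c t (real \<beta>) \<delta>)) \<and>
      ((\<forall>n. root_type (roots_of (M n)) \<in> {Type_BC, Type_C} \<and>
             mult_alpha (roots_of (M n)) \<in> {0, 4}) \<longrightarrow>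
         has_log_limit c M \<sigma> (- E_C c t (real \<beta>))))"
proof (rule conjI; intro allI impI conjI)
  fix \<beta> :: real assume \<beta>: "\<beta> > 0"
  interpret A: log_gas "c / (2 * t)" \<beta> 0 False using assms \<beta> by (rule log_gas_A)
  show "\<bar>E_A c t \<beta>\<bar> \<noteq> \<infinity>" using E_A_eq[OF assms \<beta>] A.E_finite by simp
  show BC: "\<bar>E_BC c t \<beta> \<delta>\<bar> \<noteq> \<infinity>" if "\<delta> \<ge> 1" for \<delta>
  proof -
    interpret BC: log_gas "c / (2 * t)" \<beta> "\<beta> * (\<delta> - 1)" True using assms \<beta> that by (rule log_gas_BC)
    show ?thesis using E_BC_eq[OF assms \<beta> that] BC.E_finite by simp
  qed
  from this[of 1] show "\<bar>E_C c t \<beta>\<bar> \<noteq> \<infinity>" by (simp add: E_BC_1)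
next
  fix M \<sigma> \<beta> \<gamma> assume seq: "large_rank_sequence t \<beta> \<gamma> M \<sigma>"
  have irred: "irreducible_noncompact (M n)" for n
    using seq by (simp add: large_rank_sequence_def)
  \<comment> \<open>Constant multiplicities are entirely remainder, with \<delta> = 1; in
    \<open>linear\<close> the remainder is 0.\<close>
  have const: "has_log_limit c M \<sigma> (- E_C c t (real \<beta>))"
    if "\<And>n. root_type (roots_of (M n)) \<noteq> Type_A" "\<And>n. mult_alpha (roots_of (M n)) \<in> {0, 4}"
    using has_log_limit_BC[OF assms order_refl seq that(1), of "\<lambda>n. real (mult_alpha (roots_of (M n)))"] that(2)
    by (force simp: E_BC_1)
  have linear: "has_log_limit c M \<sigma> (- E_BC c t (real \<beta>) \<delta>)"
    if "\<delta> \<ge> 1" "\<And>n. root_type (roots_of (M n)) \<noteq> Type_A"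
      "\<And>n. real (mult_alpha (roots_of (M n))) = real \<beta> * (\<delta> - 1) * real (root_rank (roots_of (M n)))" for \<delta>
    using has_log_limit_BC[OF assms that(1) seq that(2), of "\<lambda>_. 0"] that(3) by simp
  {
    assume "\<forall>n. root_type (roots_of (M n)) = Type_A"
    then show "has_log_limit c M \<sigma> (- E_A c t (real \<beta>))"
      using has_log_limit_A[OF assms seq] by blast
  next
    fix \<delta> :: real assume "\<delta> \<ge> 1" and H: "\<forall>n. root_type (roots_of (M n)) \<in> {Type_B, Type_D} \<and>
             real (mult_alpha (roots_of (M n))) = real \<beta> * (\<delta> - 1) * real (root_rank (roots_of (M n)))"
    have "root_type (roots_of (M n)) \<noteq> Type_A" for n using H by (metis empty_iff insert_iff root_type.distinct)
    then show "has_log_limit c M \<sigma> (- E_BC c t (real \<beta>) \<delta>)" using linear[OF \<open>\<delta> \<ge> 1\<close>] H by blast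
  next
    assume H: "\<forall>n. root_type (roots_of (M n)) \<in> {Type_C, Type_D}"
    have "root_type (roots_of (M n)) \<noteq> Type_A" for n using H by (metis empty_iff insert_iff root_type.distinct)
    moreover have "mult_alpha (roots_of (M n)) \<in> {0, 4}" for n
      using roots_of_mult(2)[OF irred] H by blast
    ultimately show "has_log_limit c M \<sigma> (- E_C c t (real \<beta>))" using const by blast
  next
    fix \<delta> :: real assume "\<delta> \<ge> 1" and H: "\<forall>n. root_type (roots_of (M n)) \<in> {Type_BC, Type_C} \<and>
             real (mult_alpha (roots_of (M n))) = real \<beta> * (\<delta> - 1) * real (root_rank (roots_of (M n)))"
    have "root_type (roots_of (M n)) \<noteq> Type_A" for n using H by (metis empty_iff insert_iff root_type.distinct)
    then show "has_log_limit c M \<sigma> (- E_BC c t (real \<beta>) \<delta>)" using linear[OF \<open>\<delta> \<ge> 1\<close>] H by blast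
  next
    assume H: "\<forall>n. root_type (roots_of (M n)) \<in> {Type_BC, Type_C} \<and> mult_alpha (roots_of (M n)) \<in> {0, 4}"
    have "root_type (roots_of (M n)) \<noteq> Type_A" for n using H by (metis empty_iff insert_iff root_type.distinct)
    then show "has_log_limit c M \<sigma> (- E_C c t (real \<beta>))" using const H by blast
  }
qed

end
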